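(* Let $\{r,s,t\}=\{1,2,3\}$ and let $\mathbb A=\mathbb A^3_{r,s}(p_1,p_2)$ be the algebra defined by two real parameters $p_1,p_2$. Consider an $\mathbb A$-algebrizable vector field $F=(f_1,f_2,f_3)$ defined on an open set $\Omega\subset\mathbb R^3$, and $E_i:=e_iF$ (product in $\mathbb A$) for $i=1,2,3$. Then $$E_r=e_rF=f_re_r,\qquad E_s=e_sF=f_se_s+f_te_t,\qquad E_t=e_tF=p_1f_te_s+(f_s+p_2f_t)e_t.$$ In addition, $$\int_\gamma\frac eF\,d\xi=\left(\int_\gamma G_1\cdot ds,\int_\gamma G_2\cdot ds,\int_\gamma G_3\cdot ds\right),$$ where $\gamma$ is a differentiable path contained in $\Omega(F,\mathbb A^* )$ and $G_r,G_s,G_t$ are the conservative vector fields given by $$G_r=\frac1{f_r}e_r,$$ $$G_s=\frac{f_s+p_2f_t}{f_s^2+p_2f_sf_t-p_1f_t^2}e_s-\frac{p_1f_t}{f_s^2+p_2f_sf_t-p_1f_t^2}e_t,$$ $$G_t=\frac{-f_t}{f_s^2+p_2f_sf_t-p_1f_t^2}e_s+\frac{f_s}{f_s^2+p_2f_sf_t-p_1f_t^2}e_t.$$ Moreover, $\langle E_i,G_j\rangle=\delta_{ij}$ for $i,j\in\{1,2,3\}$. Thus, the potential function $h_i$ of $G_i$ given, when $G_i=(P,Q,S)$, by $$h_i(w)=\int P(w)\,dx_1+\int\left(Q(w)-\frac{\partial}{\partial x_2}\int P(w)\,dx_1\right)dx_2,\qquad w=(x_1,x_2,x_3),$$ is a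 first integral for $E_j$ for $i,j\in\{1,2,3\}$ and $i\ne j$.
   Context: $\mathbb A^3_{r,s}(p_1,p_2)$ denotes $\mathbb R^3$ (canonical basis $e_1,e_2,e_3$) with the commutative, associative, bilinear product given by $e_re_r=e_r$, $e_re_s=e_re_t=0$, $e_se_s=e_s$, $e_se_t=e_t$, $e_te_t=p_1e_s+p_2e_t$; its unit is $e=e_r+e_s$. $\mathbb A^*$ is the set of regular (invertible) elements, the inverse of $a$ being written $\frac ea$. A vector field $F:\Omega\to\mathbb R^3$ is $\mathbb A$-algebrizable if there is $F':\Omega\to\mathbb R^3$ with $\lim_{\xi\to0}|F(w+\xi)-F(w)-F'(w)\xi|/|\xi|=0$ for all $w\in\Omega$ (product in $\mathbb A$). $\Omega(F,\mathbb A^* )=F^{-1}(\mathbb A^* )$, and $\frac eF$ is the function $w\mapsto F(w)^{-1}$ on it. For a differentiable curve $\gamma:[0,a]\to\Omega(F,\mathbb A^* )$, $\int_\gamma\frac eF\,d\xi=\int_0^a\frac e{F(\gamma(t))}\dot\gamma(t)\,dt$ (product in $\mathbb A$) and $\int_\gamma G\cdot ds=\int_0^a\langle G(\gamma(t)),\dot\gamma(t)\rangle\,dt$, with $\langle\cdot,\cdot\rangle$ the usual inner product of $\mathbb R^3$. $\delta_{ij}$ is the Kronecker delta. A conservative vector field is a gradient field; a first integral of $E$ is a differentiable function $h$ with $\langle\nabla h,E\rangle=0$.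
   Formalization: G_i is shown conservative on simply connected open subsets of Ω(F,A* ), as it can fail on all of it (p1=-1, p2=0, F(w)=w). The formula for h_i is read with indefinite integrals and a suitable choice of integration constants, since it omits an x_3 term. *)

theory Defs
  imports "HOL-Analysis.Analysis"
begin

text \<open>
  The product is the bilinear extension of the multiplication table of the canonical basis
  \<open>axis i 1\<close>. The index \<open>t\<close> is determined by \<open>r\<close> and \<open>s\<close> through \<open>{r, s, t} = {1, 2, 3}\<close>, but it
  is carried as an explicit parameter.
\<close>

definition basis_prod :: "3 \<Rightarrow> 3 \<Rightarrow> 3 \<Rightarrow> real \<Rightarrow> real \<Rightarrow> 3 \<Rightarrow> 3 \<Rightarrow> real ^ 3" where
  "basis_prod r s t p1 p2 i j =
    (if i = r \<and> j = r then axis r 1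
     else if i = s \<and> j = s then axis s 1
     else if (i = s \<and> j = t) \<or> (i = t \<and> j = s) then axis t 1
     else if i = t \<and> j = t then p1 *\<^sub>R axis s 1 + p2 *\<^sub>R axis t 1
     else 0)"

definition alg_mult :: "3 \<Rightarrow> 3 \<Rightarrow> 3 \<Rightarrow> real \<Rightarrow> real \<Rightarrow> real ^ 3 \<Rightarrow> real ^ 3 \<Rightarrow> real ^ 3" where
  "alg_mult r s t p1 p2 x y =
    (\<Sum>i\<in>UNIV. \<Sum>j\<in>UNIV. (x $ i * y $ j) *\<^sub>R basis_prod r s t p1 p2 i j)"

definition alg_unit :: "3 \<Rightarrow> 3 \<Rightarrow> real ^ 3" where
  "alg_unit r s = axis r 1 + axis s 1"

definition alg_regular :: "3 \<Rightarrow> 3 \<Rightarrow> 3 \<Rightarrow> real \<Rightarrow> real \<Rightarrow> (real ^ 3) set" where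
  "alg_regular r s t p1 p2 = {a. \<exists>b. alg_mult r s t p1 p2 a b = alg_unit r s}"

definition alg_inverse :: "3 \<Rightarrow> 3 \<Rightarrow> 3 \<Rightarrow> real \<Rightarrow> real \<Rightarrow> real ^ 3 \<Rightarrow> real ^ 3" where
  "alg_inverse r s t p1 p2 a = (THE b. alg_mult r s t p1 p2 a b = alg_unit r s)"

definition algebrizable_on ::
  "3 \<Rightarrow> 3 \<Rightarrow> 3 \<Rightarrow> real \<Rightarrow> real \<Rightarrow> (real ^ 3) set \<Rightarrow> (real ^ 3 \<Rightarrow> real ^ 3) \<Rightarrow> bool" where
  "algebrizable_on r s t p1 p2 \<Omega> F \<longleftrightarrow>
    (\<exists>F'. \<forall>w\<in>\<Omega>.
      ((\<lambda>\<xi>. norm (F (w + \<xi>) - F w - alg_mult r s t p1 p2 (F' w) \<xi>) / norm \<xi>) \<longlongrightarrow> 0) (at 0))"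

definition regular_domain ::
  "3 \<Rightarrow> 3 \<Rightarrow> 3 \<Rightarrow> real \<Rightarrow> real \<Rightarrow> (real ^ 3) set \<Rightarrow> (real ^ 3 \<Rightarrow> real ^ 3) \<Rightarrow> (real ^ 3) set" where
  "regular_domain r s t p1 p2 \<Omega> F = {w \<in> \<Omega>. F w \<in> alg_regular r s t p1 p2}"

text \<open>
  The integrands of the two line integrals along \<open>\<gamma> : [0, a] \<rightarrow> \<real>\<^sup>3\<close>: the algebra-valued one
  of \<open>e / F\<close>, and the scalar one of a vector field \<open>G\<close>.
\<close>

definition alg_integrand ::
  "3 \<Rightarrow> 3 \<Rightarrow> 3 \<Rightarrow> real \<Rightarrow> real \<Rightarrow> (real ^ 3 \<Rightarrow> real ^ 3) \<Rightarrow> (real \<Rightarrow> real ^ 3) \<Rightarrow> real \<Rightarrow> real \<Rightarrow> real ^ 3"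
  where
  "alg_integrand r s t p1 p2 F \<gamma> a \<tau> =
    alg_mult r s t p1 p2 (alg_inverse r s t p1 p2 (F (\<gamma> \<tau>)))
      (vector_derivative \<gamma> (at \<tau> within {0..a}))"

definition line_integrand ::
  "(real ^ 3 \<Rightarrow> real ^ 3) \<Rightarrow> (real \<Rightarrow> real ^ 3) \<Rightarrow> real \<Rightarrow> real \<Rightarrow> real" where
  "line_integrand G \<gamma> a \<tau> = G (\<gamma> \<tau>) \<bullet> vector_derivative \<gamma> (at \<tau> within {0..a})"

text \<open>
  The relevant fields are closed but in general not gradients on all of \<open>\<Omega>(F, \<A>\<^sup>*)\<close>: for \<open>p1 = -1\<close>,
  \<open>p2 = 0\<close>, \<open>F w = w\<close> the field \<open>G\<^sub>t\<close> is the angle form on the \<open>(s, t)\<close> plane. Potentials are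
  therefore relative to an open set \<open>U\<close>.
\<close>

definition potential_on :: "(real ^ 3) set \<Rightarrow> (real ^ 3 \<Rightarrow> real ^ 3) \<Rightarrow> (real ^ 3 \<Rightarrow> real) \<Rightarrow> bool" where
  "potential_on U G h \<longleftrightarrow> (\<forall>w\<in>U. GDERIV h w :> G w)"

definition conservative_on :: "(real ^ 3) set \<Rightarrow> (real ^ 3 \<Rightarrow> real ^ 3) \<Rightarrow> bool" where
  "conservative_on U G \<longleftrightarrow> (\<exists>h. potential_on U G h)"

definition first_integral_on ::
  "(real ^ 3) set \<Rightarrow> (real ^ 3 \<Rightarrow> real ^ 3) \<Rightarrow> (real ^ 3 \<Rightarrow> real) \<Rightarrow> bool" where
  "first_integral_on U E h \<longleftrightarrow> (\<forall>w\<in>U. \<exists>g. (GDERIV h w :> g) \<and> g \<bullet> E w = 0)"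

definition partial_deriv_on ::
  "(real ^ 3) set \<Rightarrow> 3 \<Rightarrow> (real ^ 3 \<Rightarrow> real) \<Rightarrow> (real ^ 3 \<Rightarrow> real) \<Rightarrow> bool" where
  "partial_deriv_on U k f d \<longleftrightarrow>
    (\<forall>w\<in>U. ((\<lambda>\<tau>. f (w + \<tau> *\<^sub>R axis k 1)) has_real_derivative d w) (at 0))"

text \<open>
  The formula \<open>\<integral> P dx\<^sub>1 + \<integral> (Q - \<partial>/\<partial>x\<^sub>2 \<integral> P dx\<^sub>1) dx\<^sub>2\<close> is read with indefinite integrals:
  \<open>A\<close> is an antiderivative of \<open>P\<close> in \<open>x\<^sub>1\<close>, with partial derivative \<open>D\<close> in \<open>x\<^sub>2\<close>, and \<open>B\<close> is an
  antiderivative of \<open>Q - D\<close> in \<open>x\<^sub>2\<close>. The constants of integration may depend on the remaining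
  variables, so the sum \<open>A + B\<close> need not be a potential for every choice of \<open>B\<close>: the formula does
  not mention the third component of the field. With definite integrals from a base point it
  misses a function of \<open>x\<^sub>3\<close>.
\<close>

definition first_antiderivative_on ::
  "(real ^ 3) set \<Rightarrow> (real ^ 3 \<Rightarrow> real ^ 3) \<Rightarrow> (real ^ 3 \<Rightarrow> real) \<Rightarrow> (real ^ 3 \<Rightarrow> real) \<Rightarrow> bool" where
  "first_antiderivative_on U G A D \<longleftrightarrow>
    partial_deriv_on U 1 A (\<lambda>w. G w $ 1) \<and> partial_deriv_on U 2 A D"

definition second_antiderivative_on ::
  "(real ^ 3) set \<Rightarrow> (real ^ 3 \<Rightarrow> real ^ 3) \<Rightarrow> (real ^ 3 \<Rightarrow> real) \<Rightarrow> (real ^ 3 \<Rightarrow> real) \<Rightarrow> bool" where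
  "second_antiderivative_on U G D B \<longleftrightarrow> partial_deriv_on U 2 B (\<lambda>w. G w $ 2 - D w)"

end

theory Submission
  imports Defs
begin

text \<open>
Everything rests on one formula. On the set where \<open>F\<close> is regular, \<open>G\<^sub>i(w) \<bullet> \<xi>\<close> is the \<open>i\<close>-th
component of \<open>(e / F(w)) \<xi>\<close>: the \<open>G\<^sub>i\<close> are the rows of the matrix of multiplication by \<open>e / F\<close>.
Hence the \<open>\<A>\<close>-valued line integral of \<open>e / F\<close> has the line integrals of the \<open>G\<^sub>i\<close> as components, and
\<open>\<langle>E\<^sub>i, G\<^sub>j\<rangle>\<close> is the \<open>j\<close>-th component of \<open>(e / F) (e\<^sub>i F) = e\<^sub>i\<close>
(\<open>dual_field_basis\<close>). The latter makes every potential of \<open>G\<^sub>i\<close> a first integral of \<open>E\<^sub>j\<close> for \<open>j \<noteq> i\<close>.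

The formula also shows that \<open>G\<^sub>i\<close> is a closed field: the derivative of \<open>e / F\<close> in direction
\<open>\<eta>\<close> is \<open>- F\<^sup>-\<^sup>2 F' \<eta>\<close>, so the derivative of \<open>G\<^sub>i\<close> is the bilinear form
\<open>- (F\<^sup>-\<^sup>2 F' \<eta> \<xi>)\<^sub>i\<close>, symmetric in \<open>\<eta>\<close> and \<open>\<xi>\<close> (\<open>dual_field_closed\<close>). What remains is to pass
from closed to conservative. But \<open>F'\<close> can be discontinuous: \<open>F w = \<phi>(w $ r) e\<^sub>r + e\<^sub>s\<close>
is algebrizable for every differentiable \<open>\<phi>\<close>, with \<open>F' w = \<phi>'(w $ r) e\<^sub>r\<close>. So the Poincare lemma
for continuously differentiable fields does not apply. On convex sets it is replaced by Goursat's
bisection of triangles (\<open>potential_of_closed_field_on_convex\<close>). On a simply connected set the potentials on balls are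
glued by summing small increments along paths, a sum invariant under homotopies with fixed ends
(\<open>locally_additive_potential\<close>).

The same local potentials give the existence of the line integrals along a curve that is merely
differentiable (\<open>line_integrand_integrable\<close>). Finally, given an antiderivative \<open>A\<close> of the first
component of \<open>G\<^sub>i\<close> and any potential \<open>h\<close>, the function \<open>B = h - A\<close> is an antiderivative of the kind
that the formula for \<open>h\<^sub>i\<close> asks for.
\<close>

section \<open>Goursat's argument for closed vector fields\<close>

definition segment_integral :: "('a::euclidean_space \<Rightarrow> 'a) \<Rightarrow> 'a \<Rightarrow> 'a \<Rightarrow> real" where
  "segment_integral G a b = integral {0..1} (\<lambda>x. G (linepath a b x) \<bullet> (b - a))"

definition triangle_integral :: "('a::euclidean_space \<Rightarrow> 'a) \<Rightarrow> 'a \<Rightarrow> 'a \<Rightarrow> 'a \<Rightarrow> real" where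
  "triangle_integral G a b c = segment_integral G a b + segment_integral G b c + segment_integral G c a"

lemma segment_integrand_integrable:
  assumes "continuous_on (closed_segment a b) G"
  shows "(\<lambda>x. G (linepath a b x) \<bullet> (b - a)) integrable_on {0..1}"
proof (rule integrable_continuous_interval, intro continuous_intros)
  have "continuous_on {0..1} (G \<circ> linepath a b)"
    using assms by (intro continuous_on_compose continuous_intros) (simp add: linepath_image_01)
  then show "continuous_on {0..1} (\<lambda>x. G (linepath a b x))" by (simp add: o_def)
qed

lemma segment_integral_gradient:
  fixes G :: "'a::euclidean_space \<Rightarrow> 'a"
  assumes "\<And>w. w \<in> closed_segment a b \<Longrightarrow> GDERIV h w :> G w"
  shows "segment_integral G a b = h b - h a"
proof -
  have "((\<lambda>x. G (linepath a b x) \<bullet> (b - a)) has_integral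
      (h (linepath a b 1) - h (linepath a b 0))) {0..1}"
  proof (rule fundamental_theorem_of_calculus)
    fix x :: real assume x: "x \<in> {0..1}"
    then have "linepath a b x \<in> closed_segment a b" 
      by (auto simp flip: linepath_image_01)
    then have "(h has_derivative (\<lambda>v. v \<bullet> G (linepath a b x))) (at (linepath a b x))"
      using assms by (simp add: gderiv_def)
    then have "(h has_derivative (\<lambda>v. v \<bullet> G (linepath a b x)))
        (at (linepath a b x) within linepath a b ` {0..1})"
      by (rule has_derivative_at_withinI)
    moreover have "(linepath a b has_vector_derivative (b - a)) (at x within {0..1})"
      by (rule has_vector_derivative_linepath_within)
    ultimately have "((h \<circ> linepath a b) has_vector_derivative (b - a) \<bullet> G (linepath a b x))
        (at x within {0..1})"
      using vector_derivative_diff_chain_within by blast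
    then show "((\<lambda>x. h (linepath a b x)) has_vector_derivative G (linepath a b x) \<bullet> (b - a))
        (at x within {0..1})"
      by (simp add: o_def inner_commute)
  qed simp
  then show ?thesis
    by (simp add: segment_integral_def integral_unique linepath_0' linepath_1')
qed

text \<open>
The integrand along \<open>[a, b]\<close> has an antiderivative \<open>\<phi>\<close> in the parameter, and the integral over
any subsegment, in either direction, is an increment of \<open>\<phi>\<close>. Reversal and bisection of a segment
are two instances.
\<close>

lemma segment_integral_antiderivative:
  assumes "continuous_on (closed_segment a b) G"
  obtains \<phi> where "\<And>u v. u \<in> {0..1} \<Longrightarrow> v \<in> {0..1} \<Longrightarrow>
    segment_integral G (linepath a b u) (linepath a b v) = \<phi> v - \<phi> u"
proof -
  define f where "f = (\<lambda>x. G (linepath a b x) \<bullet> (b - a))"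
  have "continuous_on {0..1} (G \<circ> linepath a b)"
    using assms by (intro continuous_on_compose continuous_intros) (simp add: linepath_image_01)
  then have "continuous_on {0..1} f" unfolding f_def o_def by (intro continuous_intros)
  then obtain \<phi> where \<phi>: "\<And>x. x \<in> {0..1} \<Longrightarrow> (\<phi> has_vector_derivative f x) (at x within {0..1})"
    using antiderivative_continuous by blast
  have "segment_integral G (linepath a b u) (linepath a b v) = \<phi> v - \<phi> u"
    if uv: "u \<in> {0..1}" "v \<in> {0..1}" for u v
  proof -
    have sub: "linepath u v x \<in> {0..1}" if "x \<in> {0..1}" for x
    proof -
      have "linepath u v x \<in> closed_segment u v"
        using that by (auto simp flip: linepath_image_01)
      moreover have "closed_segment u v \<subseteq> {0..1}"
        using uv by (intro closed_segment_subset) auto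
      ultimately show ?thesis by blast
    qed
    have "((\<lambda>x. (v - u) * f (linepath u v x)) has_integral
        (\<phi> (linepath u v 1) - \<phi> (linepath u v 0))) {0..1}"
    proof (rule fundamental_theorem_of_calculus)
      fix x :: real assume x: "x \<in> {0..1}"
      have "(\<phi> has_vector_derivative f (linepath u v x))
          (at (linepath u v x) within linepath u v ` {0..1})"
        using sub by (intro has_vector_derivative_within_subset[OF \<phi>[OF sub[OF x]]]) auto
      from vector_diff_chain_within[OF has_vector_derivative_linepath_within this]
      show "((\<lambda>x. \<phi> (linepath u v x)) has_vector_derivative (v - u) * f (linepath u v x))
          (at x within {0..1})"
        by (simp add: o_def)
    qed simp
    moreover have "linepath (linepath a b u) (linepath a b v) x = linepath a b (linepath u v x)"
      "linepath a b v - linepath a b u = (v - u) *\<^sub>R (b - a)" for x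
      by (simp_all add: linepath_def algebra_simps)
    ultimately show ?thesis
      by (auto simp: segment_integral_def f_def linepath_0' linepath_1' dest: integral_unique)
  qed
  then show thesis using that by blast
qed

lemma segment_integral_reverse:
  assumes "continuous_on (closed_segment a b) G"
  shows "segment_integral G b a = - segment_integral G a b"
proof -
  obtain \<phi> where \<phi>: "\<And>u v. u \<in> {0..1} \<Longrightarrow> v \<in> {0..1} \<Longrightarrow>
    segment_integral G (linepath a b u) (linepath a b v) = \<phi> v - \<phi> u"
    using segment_integral_antiderivative[OF assms] by blast
  from \<phi>[of 0 1] \<phi>[of 1 0] show ?thesis by (simp add: linepath_0' linepath_1')
qed

lemma segment_integral_midpoint:
  assumes "continuous_on (closed_segment a b) G"
  shows "segment_integral G a (midpoint a b) + segment_integral G (midpoint a b) b = segment_integral G a b"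
proof -
  obtain \<phi> where \<phi>: "\<And>u v. u \<in> {0..1} \<Longrightarrow> v \<in> {0..1} \<Longrightarrow>
    segment_integral G (linepath a b u) (linepath a b v) = \<phi> v - \<phi> u"
    using segment_integral_antiderivative[OF assms] by blast
  have "linepath a b (1/2) = midpoint a b"
    by (simp add: linepath_def midpoint_def scaleR_add_right)
  with \<phi>[of 0 "1/2"] \<phi>[of "1/2" 1] \<phi>[of 0 1] show ?thesis by (simp add: linepath_0' linepath_1')
qed

lemma segment_integral_diff:
  assumes "continuous_on (closed_segment a b) G" "continuous_on (closed_segment a b) H"
  shows "segment_integral (\<lambda>w. G w - H w) a b = segment_integral G a b - segment_integral H a b"
  unfolding segment_integral_def inner_diff_left
  by (intro integral_diff segment_integrand_integrable assms)

lemma segment_integral_bound: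
  assumes "continuous_on (closed_segment a b) G"
    and B: "0 \<le> B" "\<And>w. w \<in> closed_segment a b \<Longrightarrow> norm (G w) \<le> B"
  shows "\<bar>segment_integral G a b\<bar> \<le> B * norm (b - a)"
proof -
  have "((\<lambda>x. G (linepath a b x) \<bullet> (b - a)) has_integral segment_integral G a b) (cbox 0 1)"
    using segment_integrand_integrable[OF assms(1)] 
    by (simp add: segment_integral_def has_integral_integral)
  then have "norm (segment_integral G a b) \<le> B * norm (b - a) * measure lborel (cbox 0 (1::real))"
  proof (rule has_integral_bound[rotated])
    fix x :: real assume "x \<in> cbox 0 1"
    then have "linepath a b x \<in> closed_segment a b"
      by (auto simp flip: linepath_image_01)
    then have "norm (G (linepath a b x)) * norm (b - a) \<le> B * norm (b - a)"
      using B by (intro mult_right_mono) auto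
    then show "norm (G (linepath a b x) \<bullet> (b - a)) \<le> B * norm (b - a)"
      using Cauchy_Schwarz_ineq2[of "G (linepath a b x)" "b - a"] by simp
  qed (use B in simp)
  then show ?thesis by simp
qed

text \<open>
The midpoints of the sides cut the triangle into four triangles of half the size whose integrals
add up to that of the whole, so one of them carries at least a quarter of it.
\<close>

lemma triangle_integral_quadrisection:
  fixes G :: "'a::euclidean_space \<Rightarrow> 'a"
  assumes G: "continuous_on (convex hull {a,b,c}) G"
    and dist: "dist a b \<le> K" "dist b c \<le> K" "dist c a \<le> K"
    and e: "e * K^2 \<le> \<bar>triangle_integral G a b c\<bar>"
  shows "\<exists>a' b' c'. {a', b', c'} \<subseteq> convex hull {a,b,c} \<and>
           dist a' b' \<le> K/2 \<and> dist b' c' \<le> K/2 \<and> dist c' a' \<le> K/2 \<and>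
           e * (K/2)^2 \<le> \<bar>triangle_integral G a' b' c'\<bar>"
    (is "\<exists>x y z. ?\<Phi> x y z")
proof -
  define a' where "a' = midpoint b c"
  define b' where "b' = midpoint c a"
  define c' where "c' = midpoint a b"
  have in_hull: "{a, b, c, a', b', c'} \<subseteq> convex hull {a,b,c}"
    unfolding a'_def b'_def c'_def
    by (auto simp: midpoints_in_convex_hull hull_inc)
  have cont: "continuous_on (closed_segment x y) G"
    if "x \<in> {a, b, c, a', b', c'}" "y \<in> {a, b, c, a', b', c'}" for x y
    using that in_hull
    by (intro continuous_on_subset[OF G] closed_segment_subset convex_convex_hull) blast+
  note segment_integral_midpoint[OF cont, of a b] segment_integral_midpoint[OF cont, of b c]
    segment_integral_midpoint[OF cont, of c a]
  moreover note segment_integral_reverse[OF cont, of a' b'] segment_integral_reverse[OF cont, of b' c']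
    segment_integral_reverse[OF cont, of c' a']
  ultimately have *: "triangle_integral G a b c =
      triangle_integral G a c' b' + triangle_integral G a' c' b
      + triangle_integral G a' c b' + triangle_integral G a' b' c'"
    by (simp add: triangle_integral_def a'_def[symmetric] b'_def[symmetric] c'_def[symmetric])
  have halves: "dist x c' \<le> K/2" "dist c' x \<le> K/2" if "x = a \<or> x = b" for x
    using that dist unfolding c'_def by (auto simp: dist_midpoint dist_commute)
  have halves': "dist x a' \<le> K/2" "dist a' x \<le> K/2" if "x = b \<or> x = c" for x
    using that dist unfolding a'_def by (auto simp: dist_midpoint dist_commute)
  have halves'': "dist x b' \<le> K/2" "dist b' x \<le> K/2" if "x = c \<or> x = a" for x
    using that dist unfolding b'_def by (auto simp: dist_midpoint dist_commute)
  have mids: "dist a' b' \<le> K/2" "dist b' c' \<le> K/2" "dist c' a' \<le> K/2"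
  proof -
    have *: "a' - b' = (1/2) *\<^sub>R (b - a)" "b' - c' = (1/2) *\<^sub>R (c - b)" "c' - a' = (1/2) *\<^sub>R (a - c)"
      by (auto simp: a'_def b'_def c'_def midpoint_def algebra_simps)
    then show "dist a' b' \<le> K/2" "dist b' c' \<le> K/2" "dist c' a' \<le> K/2"
      using dist unfolding dist_norm * by (auto simp: norm_minus_commute)
  qed
  from mids have mids': "dist b' a' \<le> K/2" "dist c' b' \<le> K/2" "dist a' c' \<le> K/2"
    by (simp_all add: dist_commute)
  note d = halves halves' halves'' mids mids'
  have "e * K\<^sup>2 = 4 * (e * (K/2)\<^sup>2)" by (simp add: power_divide)
  then consider "e * (K/2)\<^sup>2 \<le> \<bar>triangle_integral G a c' b'\<bar>"
    | "e * (K/2)\<^sup>2 \<le> \<bar>triangle_integral G a' c' b\<bar>"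
    | "e * (K/2)\<^sup>2 \<le> \<bar>triangle_integral G a' c b'\<bar>"
    | "e * (K/2)\<^sup>2 \<le> \<bar>triangle_integral G a' b' c'\<bar>"
    using e unfolding * by linarith
  then show ?thesis
  proof cases
    case 1
    then have "?\<Phi> a c' b'" using in_hull d by auto
    then show ?thesis by blast
  next
    case 2
    then have "?\<Phi> a' c' b" using in_hull d by auto
    then show ?thesis by blast
  next
    case 3
    then have "?\<Phi> a' c b'" using in_hull d by auto
    then show ?thesis by blast
  next
    case 4
    then have "?\<Phi> a' b' c'" using in_hull d by auto
    then show ?thesis by blast
  qed
qed

text \<open>
If the derivative of \<open>G\<close> at the single point \<open>x\<close> is symmetric, the integral of \<open>G\<close> over a triangle
with sides at most \<open>K\<close> containing \<open>x\<close> is \<open>o(K\<^sup>2)\<close>: the first-order part of \<open>G\<close> is a gradient, and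
the remainder is \<open>o(K)\<close> along a boundary of length at most \<open>3 K\<close>.
\<close>

lemma triangle_integral_small:
  fixes G :: "'a::euclidean_space \<Rightarrow> 'a"
  assumes S: "continuous_on S G" and DG: "(G has_derivative D) (at x within S)"
    and sym: "\<And>u v. D u \<bullet> v = D v \<bullet> u" and e: "0 < e"
  shows "\<exists>d>0. \<forall>a b c K. convex hull {a,b,c} \<subseteq> S \<and> x \<in> convex hull {a,b,c} \<and>
     dist a b \<le> K \<and> dist b c \<le> K \<and> dist c a \<le> K \<and> K < d \<longrightarrow>
     \<bar>triangle_integral G a b c\<bar> \<le> e * K\<^sup>2"
proof -
  have D: "bounded_linear D" using DG by (rule has_derivative_bounded_linear)
  have "0 < e / 3" using e by simp
  then obtain d where d: "d > 0" "\<And>y. y \<in> S \<Longrightarrow> norm (y - x) < d \<Longrightarrow>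
      norm (G y - G x - D (y - x)) \<le> e / 3 * norm (y - x)"
    using DG unfolding has_derivative_within_alt by blast
  define H where "H = (\<lambda>w. G x + D (w - x))"
  \<comment> \<open>The first-order part \<open>H\<close> of \<open>G\<close> at \<open>x\<close> is the gradient of the quadratic \<open>h\<close>: this is where
    the symmetry of the derivative enters. So \<open>H\<close> contributes nothing to a closed triangle.\<close>
  define h where "h = (\<lambda>w. G x \<bullet> w + (D (w - x) \<bullet> (w - x)) / 2)"
  have contH: "continuous_on T H" for T
    unfolding H_def by (intro continuous_intros bounded_linear.continuous_on[OF D])
  have grad: "GDERIV h w :> H w" for w
  proof -
    have "D v \<bullet> (w - x) = D (w - x) \<bullet> v" for v by (rule sym)
    then show ?thesis
      unfolding gderiv_def h_def H_def
      by (auto simp: inner_add_right inner_commute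
          intro!: ext derivative_eq_intros bounded_linear.has_derivative[OF D])
  qed
  have "\<bar>triangle_integral G a b c\<bar> \<le> e * K\<^sup>2"
    if hull: "convex hull {a,b,c} \<subseteq> S" and x: "x \<in> convex hull {a,b,c}"
      and K: "dist a b \<le> K" "dist b c \<le> K" "dist c a \<le> K" "K < d" for a b c K
  proof -
    have near: "norm (y - x) \<le> K" if "y \<in> convex hull {a,b,c}" for y
    proof -
      have "\<exists>u\<in>{a,b,c}. \<exists>v\<in>{a,b,c}. norm (y - x) \<le> norm (u - v)"
        using that x by (intro simplex_extremal_le_exists) auto
      then obtain u v where uv: "u \<in> {a,b,c}" "v \<in> {a,b,c}" "norm (y - x) \<le> norm (u - v)"
        by blast
      have "0 \<le> K" using K(1) zero_le_dist[of a b] by linarith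
      then have "norm (u - v) \<le> K"
        using uv(1,2) K by (auto simp: dist_norm norm_minus_commute)
      with uv(3) show ?thesis by linarith
    qed
    have K0: "0 \<le> K" using near[OF x] by simp
    have side: "\<bar>segment_integral G p q - (h q - h p)\<bar> \<le> e / 3 * K * K"
      if pq: "p \<in> {a,b,c}" "q \<in> {a,b,c}" "dist p q \<le> K" for p q
    proof -
      have sub: "closed_segment p q \<subseteq> convex hull {a,b,c}"
        using pq by (intro closed_segment_subset convex_convex_hull) (auto simp: hull_inc)
      then have cG: "continuous_on (closed_segment p q) G"
        using S hull continuous_on_subset by blast
      have "segment_integral (\<lambda>w. G w - H w) p q = segment_integral G p q - (h q - h p)"
        using segment_integral_diff[OF cG contH] segment_integral_gradient[OF grad] by simp
      moreover have "\<bar>segment_integral (\<lambda>w. G w - H w) p q\<bar> \<le> (e / 3 * K) * norm (q - p)"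
      proof (rule segment_integral_bound)
        show "continuous_on (closed_segment p q) (\<lambda>w. G w - H w)"
          by (intro continuous_intros cG contH)
        show "norm (G w - H w) \<le> e / 3 * K" if "w \<in> closed_segment p q" for w
        proof -
          have w: "w \<in> convex hull {a,b,c}" using that sub by blast
          have "norm (G w - G x - D (w - x)) \<le> e / 3 * norm (w - x)"
            using w hull near[OF w] K by (intro d) auto
          also have "\<dots> \<le> e / 3 * K" using e near[OF w] by (intro mult_left_mono) auto
          finally show ?thesis by (simp add: H_def algebra_simps)
        qed
      qed (use e K0 in auto)
      moreover have "(e / 3 * K) * norm (q - p) \<le> (e / 3 * K) * K"
        using e K0 pq by (intro mult_left_mono) (auto simp: dist_norm norm_minus_commute)
      ultimately show ?thesis by linarith
    qed
    have "triangle_integral G a b c = (segment_integral G a b - (h b - h a))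
        + (segment_integral G b c - (h c - h b)) + (segment_integral G c a - (h a - h c))"
      by (simp add: triangle_integral_def)
    moreover have "\<bar>segment_integral G a b - (h b - h a)\<bar> \<le> e / 3 * K * K"
      "\<bar>segment_integral G b c - (h c - h b)\<bar> \<le> e / 3 * K * K"
      "\<bar>segment_integral G c a - (h a - h c)\<bar> \<le> e / 3 * K * K"
      by (rule side; use K in simp)+
    ultimately have "\<bar>triangle_integral G a b c\<bar> \<le> e / 3 * K * K + e / 3 * K * K + e / 3 * K * K"
      by linarith
    then show ?thesis by (simp add: power2_eq_square mult_ac)
  qed
  with d(1) show ?thesis by blast
qed

text \<open>
Goursat's argument. Repeated quadrisection of a triangle with nonzero integral would give nested
triangles of diameter \<open>K / 2\<^sup>n\<close> with integral of order \<open>(K / 2\<^sup>n)\<^sup>2\<close>, against the estimate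
\<open>triangle_integral_small\<close> at their common point. It asks only for differentiability at each
point, whereas differentiation under the integral sign or Stokes' theorem would ask for a
continuous derivative.
\<close>

lemma triangle_integral_zero:
  fixes G :: "'a::euclidean_space \<Rightarrow> 'a"
  assumes DG: "\<And>x. x \<in> convex hull {a,b,c} \<Longrightarrow> (G has_derivative D x) (at x within convex hull {a,b,c})"
    and sym: "\<And>x u v. x \<in> convex hull {a,b,c} \<Longrightarrow> D x u \<bullet> v = D x v \<bullet> u"
  shows "triangle_integral G a b c = 0"
proof (rule ccontr)
  assume nz: "triangle_integral G a b c \<noteq> 0"
  define S where "S = convex hull {a,b,c}"
  have cont: "continuous_on S G"
    using DG has_derivative_continuous_on unfolding S_def by blast
  define K where "K = 1 + dist a b + dist b c + dist c a"
  have K: "0 < K" "dist a b \<le> K" "dist b c \<le> K" "dist c a \<le> K"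
    using zero_le_dist[of a b] zero_le_dist[of b c] zero_le_dist[of c a]
    unfolding K_def by linarith+
  define e where "e = \<bar>triangle_integral G a b c\<bar> / K\<^sup>2"
  have e: "0 < e" "e * K\<^sup>2 = \<bar>triangle_integral G a b c\<bar>"
    using nz K by (auto simp: e_def)
  define At where "At = (\<lambda>(x, y, z) n. convex hull {x,y,z} \<subseteq> S \<and>
      dist x y \<le> K/2^n \<and> dist y z \<le> K/2^n \<and> dist z x \<le> K/2^n \<and>
      e * (K/2^n)\<^sup>2 \<le> \<bar>triangle_integral G x y z\<bar>)"
  define hul where "hul = (\<lambda>(x::'a, y, z). convex hull {x,y,z})"
  have "\<exists>T. \<forall>n. At (T n) n \<and> hul (T (Suc n)) \<subseteq> hul (T n)"
  proof (rule dependent_nat_choice)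
    show "\<exists>t. At t 0"
      using K e by (intro exI[of _ "(a,b,c)"]) (simp add: At_def S_def)
    fix t n assume t: "At t n"
    obtain x y z where xyz: "t = (x, y, z)" by (cases t)
    have "\<exists>x' y' z'. {x', y', z'} \<subseteq> convex hull {x,y,z} \<and>
         dist x' y' \<le> K/2^n/2 \<and> dist y' z' \<le> K/2^n/2 \<and> dist z' x' \<le> K/2^n/2 \<and>
         e * (K/2^n/2)^2 \<le> \<bar>triangle_integral G x' y' z'\<bar>"
      using t unfolding xyz At_def
      by (intro triangle_integral_quadrisection continuous_on_subset[OF cont]) auto
    then obtain x' y' z' where *: "{x', y', z'} \<subseteq> convex hull {x,y,z}"
         "dist x' y' \<le> K/2^n/2" "dist y' z' \<le> K/2^n/2" "dist z' x' \<le> K/2^n/2"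
         "e * (K/2^n/2)^2 \<le> \<bar>triangle_integral G x' y' z'\<bar>" by blast
    have sub: "convex hull {x',y',z'} \<subseteq> convex hull {x,y,z}"
      using *(1) by (rule hull_minimal) simp
    have "At (x', y', z') (Suc n)" 
      using * sub t unfolding xyz At_def by (auto simp: mult.commute)
    with sub show "\<exists>t'. At t' (Suc n) \<and> hul t' \<subseteq> hul t"
      unfolding xyz hul_def by (intro exI[of _ "(x', y', z')"]) auto
  qed
  then obtain T where T: "\<And>n. At (T n) n"
    and dec: "\<And>n. hul (T (Suc n)) \<subseteq> hul (T n)" by blast
  have "\<Inter> (range (\<lambda>n. hul (T n))) \<noteq> {}"
  proof (rule compact_nest)
    show "compact (hul (T n))" "hul (T n) \<noteq> {}" for n
      unfolding hul_def by (auto split: prod.split intro: finite_imp_compact_convex_hull)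
    show "hul (T n) \<subseteq> hul (T m)" if "m \<le> n" for m n
      using that dec by (rule lift_Suc_antimono_le[rotated])
  qed
  then obtain x where x: "\<And>n. x \<in> hul (T n)" by blast
  have hulS: "hul (T n) \<subseteq> S" for n using T[of n] by (auto simp: At_def hul_def)
  then have xS: "x \<in> S" using x[of 0] by blast
  obtain d where d: "d > 0" "\<And>a b c K. convex hull {a,b,c} \<subseteq> S \<Longrightarrow> x \<in> convex hull {a,b,c} \<Longrightarrow>
     dist a b \<le> K \<Longrightarrow> dist b c \<le> K \<Longrightarrow> dist c a \<le> K \<Longrightarrow> K < d \<Longrightarrow>
     \<bar>triangle_integral G a b c\<bar> \<le> e / 2 * K\<^sup>2"
    using triangle_integral_small[of S G "D x" x "e / 2"] cont DG sym e(1) xS unfolding S_def[symmetric] 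
    by (metis half_gt_zero)
  obtain n where n: "K / 2^n < d"
  proof -
    obtain n where "K / d < 2 ^ n" using real_arch_pow[of 2 "K / d"] by auto
    then have "K / 2^n < d" using d(1) by (simp add: field_simps)
    then show thesis using that by blast
  qed
  obtain p q r where pqr: "T n = (p, q, r)" by (cases "T n")
  have "\<bar>triangle_integral G p q r\<bar> \<le> e / 2 * (K/2^n)\<^sup>2"
    using T[of n] x[of n] n unfolding pqr At_def hul_def by (intro d) auto
  moreover have "e * (K/2^n)\<^sup>2 \<le> \<bar>triangle_integral G p q r\<bar>"
    using T[of n] unfolding pqr At_def by auto
  moreover have "0 < e * (K/2^n)\<^sup>2" using e K by simp
  ultimately show False by simp
qed

text \<open>
The integral from a base point \<open>p\<close> is a potential, because its increment from \<open>w\<close> to \<open>y\<close> is the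
integral over \<open>[w, y]\<close> by the vanishing of the triangle \<open>p, w, y\<close>.
\<close>

theorem potential_of_closed_field_on_convex:
  fixes G :: "'a::euclidean_space \<Rightarrow> 'a"
  assumes "open S" "convex S"
    and DG: "\<And>x. x \<in> S \<Longrightarrow> (G has_derivative D x) (at x)"
    and sym: "\<And>x u v. x \<in> S \<Longrightarrow> D x u \<bullet> v = D x v \<bullet> u"
  shows "\<exists>h. \<forall>w\<in>S. GDERIV h w :> G w"
proof (cases "S = {}")
  case False
  then obtain p where p: "p \<in> S" by blast
  have cont: "continuous_on S G"
    using DG has_derivative_at_withinI has_derivative_continuous_on by blast
  have tri: "triangle_integral G a b c = 0" if "a \<in> S" "b \<in> S" "c \<in> S" for a b c
  proof -
    have "convex hull {a,b,c} \<subseteq> S" using that \<open>convex S\<close> by (intro hull_minimal) auto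
    then show ?thesis
      using DG sym by (intro triangle_integral_zero[of a b c G D]) (auto intro: has_derivative_at_withinI)
  qed
  have seg: "closed_segment a b \<subseteq> S" if "a \<in> S" "b \<in> S" for a b
    using that \<open>convex S\<close> by (rule closed_segment_subset)
  define h where "h = segment_integral G p"
  have incr: "h b - h a = segment_integral G a b" if "a \<in> S" "b \<in> S" for a b
    using tri[OF p that] segment_integral_reverse[OF continuous_on_subset[OF cont seg[OF p that(2)]]]
    by (simp add: h_def triangle_integral_def)
  have "GDERIV h w :> G w" if w: "w \<in> S" for w
    unfolding gderiv_def has_derivative_within_alt
  proof (intro conjI allI impI)
    show "bounded_linear (\<lambda>v. v \<bullet> G w)" by (rule bounded_linear_inner_left)
    fix e :: real assume e: "0 < e"
    have "isCont G w" using DG[OF w] by (rule has_derivative_continuous)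
    then obtain d where d: "d > 0" "\<And>y. dist y w < d \<Longrightarrow> dist (G y) (G w) < e"
      unfolding continuous_at_eps_delta using e by blast
    obtain d' where d': "d' > 0" "ball w d' \<subseteq> S"
      using \<open>open S\<close> w open_contains_ball by blast
    show "\<exists>d>0. \<forall>y\<in>UNIV. norm (y - w) < d \<longrightarrow> norm (h y - h w - (y - w) \<bullet> G w) \<le> e * norm (y - w)"
    proof (intro exI[of _ "min d d'"] conjI ballI impI)
      show "0 < min d d'" using d d' by simp
      fix y assume y: "norm (y - w) < min d d'"
      then have yS: "y \<in> S" using d' by (auto simp: subset_iff dist_norm norm_minus_commute)
      have c: "continuous_on (closed_segment w y) G"
        by (rule continuous_on_subset[OF cont seg[OF w yS]])
      have "segment_integral (\<lambda>_. G w) w y = (y - w) \<bullet> G w"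
        by (simp add: segment_integral_def inner_commute)
      then have "h y - h w - (y - w) \<bullet> G w = segment_integral (\<lambda>z. G z - G w) w y"
        using incr[OF w yS] segment_integral_diff[OF c continuous_on_const, of "G w"] by simp
      moreover have "\<bar>segment_integral (\<lambda>z. G z - G w) w y\<bar> \<le> e * norm (y - w)"
      proof (rule segment_integral_bound)
        show "continuous_on (closed_segment w y) (\<lambda>z. G z - G w)"
          by (intro continuous_intros c)
        fix z assume "z \<in> closed_segment w y"
        then have "norm (z - w) \<le> norm (y - w)"
          using segment_bound1 by blast
        then have "dist (G z) (G w) < e" using y by (intro d) (simp add: dist_norm)
        then show "norm (G z - G w) \<le> e" by (simp add: dist_norm)
      qed (use e in simp)
      ultimately show "norm (h y - h w - (y - w) \<bullet> G w) \<le> e * norm (y - w)" by simp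
    qed
  qed
  then show ?thesis by blast
qed simp

section \<open>Gluing local potentials on simply connected sets\<close>

text \<open>
The prototype of \<open>d\<close> is the integral of a closed field over the segment \<open>[a, b]\<close>. It is additive
on each ball where the field has a potential, and meaningless for \<open>[a, b]\<close> leaving the domain;
hence additivity is asked for locally only.
\<close>

definition locally_additive_on :: "'a::metric_space set \<Rightarrow> ('a \<Rightarrow> 'a \<Rightarrow> real) \<Rightarrow> bool" where
  "locally_additive_on U d \<longleftrightarrow>
    (\<forall>x\<in>U. \<exists>e>0. ball x e \<subseteq> U \<and>
      (\<forall>a\<in>ball x e. \<forall>b\<in>ball x e. \<forall>c\<in>ball x e. d a b + d b c = d a c))"

definition chain_sum :: "('a \<Rightarrow> 'a \<Rightarrow> real) \<Rightarrow> nat \<Rightarrow> (real \<Rightarrow> 'a) \<Rightarrow> real" where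
  "chain_sum d n p = (\<Sum>i<n. d (p (real i / real n)) (p (real (Suc i) / real n)))"

text \<open>
Dyadic partitions make the concatenation of paths exact at every stage: \<open>p +++ q\<close> passes from
\<open>p\<close> to \<open>q\<close> at the parameter \<open>1/2\<close>. The sequence is eventually constant on paths inside the domain
of a locally additive function.
\<close>

definition path_sum :: "('a \<Rightarrow> 'a \<Rightarrow> real) \<Rightarrow> (real \<Rightarrow> 'a) \<Rightarrow> real" where
  "path_sum d p = lim (\<lambda>k. chain_sum d (2 ^ k) p)"

lemma locally_additive_uniform:
  assumes "locally_additive_on U d" "compact C" "C \<subseteq> U"
  obtains e where "e > 0" "\<And>x a b c. x \<in> C \<Longrightarrow> a \<in> ball x e \<Longrightarrow> b \<in> ball x e \<Longrightarrow> c \<in> ball x e \<Longrightarrow>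
    d a b + d b c = d a c"
proof -
  define \<G> where "\<G> = {V. open V \<and> (\<forall>a\<in>V. \<forall>b\<in>V. \<forall>c\<in>V. d a b + d b c = d a c)}"
  have "C \<subseteq> \<Union>\<G>"
  proof
    fix x assume "x \<in> C"
    then obtain e where "e > 0" "\<forall>a\<in>ball x e. \<forall>b\<in>ball x e. \<forall>c\<in>ball x e. d a b + d b c = d a c"
      using assms unfolding locally_additive_on_def by blast
    then have "ball x e \<in> \<G>" "x \<in> ball x e" by (auto simp: \<G>_def)
    then show "x \<in> \<Union>\<G>" by blast
  qed
  moreover have "open V" if "V \<in> \<G>" for V using that by (simp add: \<G>_def)
  ultimately obtain e where e: "e > 0" "\<And>x. x \<in> C \<Longrightarrow> \<exists>V\<in>\<G>. ball x e \<subseteq> V"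
    using Heine_Borel_lemma[OF \<open>compact C\<close>] by metis
  show thesis
  proof (rule that[OF e(1)])
    fix x a b c assume "x \<in> C" and abc: "a \<in> ball x e" "b \<in> ball x e" "c \<in> ball x e"
    then obtain V where "V \<in> \<G>" "ball x e \<subseteq> V" using e by blast
    with abc show "d a b + d b c = d a c" unfolding \<G>_def by blast
  qed
qed

text \<open>
Two grid points of mesh \<open>1 / n\<close> in the unit square with both indices at most one apart, and two
points at most four steps of length \<open>1 / (2 n)\<close> apart on the line, have distance at most \<open>2 / n\<close>.
\<close>

lemma grid_points_close:
  fixes H :: "'b::metric_space \<Rightarrow> 'a::metric_space"
  assumes "compact Q" "continuous_on Q H" "e > 0"
  obtains N where "N > 0" "\<And>(n::nat) x y. n \<ge> N \<Longrightarrow> x \<in> Q \<Longrightarrow> y \<in> Q \<Longrightarrow> dist x y \<le> 2 / real n \<Longrightarrow> dist (H x) (H y) < e"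
proof -
  obtain \<delta> where \<delta>: "\<delta> > 0" "\<And>x y. x \<in> Q \<Longrightarrow> y \<in> Q \<Longrightarrow> dist y x < \<delta> \<Longrightarrow> dist (H y) (H x) < e"
    using compact_uniformly_continuous[OF assms(2,1)] assms(3)
    unfolding uniformly_continuous_on_def by metis
  obtain N :: nat where N: "2 / \<delta> < real N" using reals_Archimedean2 by blast
  then have N0: "N > 0" using \<delta>(1) by (metis divide_pos_pos gr0I not_less_iff_gr_or_eq of_nat_0 order_less_trans zero_less_numeral)
  show thesis
  proof (rule that[OF N0])
    fix n :: nat and x y assume n: "n \<ge> N" and xy: "x \<in> Q" "y \<in> Q" "dist x y \<le> 2 / real n"
    have "2 / \<delta> < real n" using N n by linarith
    then have "2 / real n < \<delta>" using \<delta>(1) n N0 by (simp add: field_simps)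
    then show "dist (H x) (H y) < e" using xy \<delta>(2)[of y x] by simp
  qed
qed

text \<open>
Cut the square on which the homotopy \<open>H\<close> is defined so finely that each cell is mapped into a ball
where \<open>d\<close> is additive. Two neighbouring rows then differ by a telescoping sum of which only the
two vertical sides are left, and these vanish since \<open>H\<close> is constant there.
\<close>

lemma chain_sum_homotopic:
  assumes d: "locally_additive_on U d" and hom: "homotopic_paths U p q"
  shows "\<exists>N>0. \<forall>n\<ge>N. chain_sum d n p = chain_sum d n q"
proof -
  obtain H :: "real \<times> real \<Rightarrow> 'a" where H: "continuous_on ({0..1} \<times> {0..1}) H" "H \<in> {0..1} \<times> {0..1} \<rightarrow> U"
    and H0: "\<forall>s\<in>{0..1}. H (0, s) = p s" and H1: "\<forall>s\<in>{0..1}. H (1, s) = q s"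
    and ends: "\<forall>\<tau>\<in>{0..1}. pathstart (H \<circ> Pair \<tau>) = pathstart p \<and> pathfinish (H \<circ> Pair \<tau>) = pathfinish p"
    using hom unfolding homotopic_paths by blast
  define Q :: "(real \<times> real) set" where "Q = {0..1} \<times> {0..1}"
  have Q: "compact Q" unfolding Q_def by (intro compact_Times) auto
  have cH: "continuous_on Q H" using H unfolding Q_def by simp
  have "compact (H ` Q)" using compact_continuous_image[OF cH Q] .
  then obtain e where e: "e > 0" "\<And>x a b c. x \<in> H ` Q \<Longrightarrow> a \<in> ball x e \<Longrightarrow> b \<in> ball x e \<Longrightarrow>
      c \<in> ball x e \<Longrightarrow> d a b + d b c = d a c"
    using locally_additive_uniform[OF d, of "H ` Q"] H(2) unfolding Q_def image_subset_iff_funcset by metis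
  obtain N where N: "N > 0" "\<And>n x y. n \<ge> N \<Longrightarrow> x \<in> Q \<Longrightarrow> y \<in> Q \<Longrightarrow> dist x y \<le> 2 / real n \<Longrightarrow> dist (H x) (H y) < e"
    using grid_points_close[OF Q cH e(1)] by metis
  have "chain_sum d n p = chain_sum d n q" if n: "n \<ge> N" for n
  proof -
    have n0: "n > 0" using n N by simp
    define v where "v = (\<lambda>i j. H (real i / real n, real j / real n))"
    have inQ: "(real i / real n, real j / real n) \<in> Q" if "i \<le> n" "j \<le> n" for i j
      using that n0 by (auto simp: Q_def divide_simps)
    have close: "v i' j' \<in> ball (v i j) e"
      if "i \<le> n" "j \<le> n" "i' \<le> n" "j' \<le> n" "i' = i \<or> i' = Suc i" "j' = j \<or> j' = Suc j" for i j i' j'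
    proof -
      have "dist (real i / real n, real j / real n) (real i' / real n, real j' / real n)
          \<le> dist (real i / real n) (real i' / real n) + dist (real j / real n) (real j' / real n)"
        unfolding dist_Pair_Pair by (rule sqrt_sum_squares_le_sum) auto
      also have "\<dots> \<le> 1 / real n + 1 / real n"
        using that by (intro add_mono) (auto simp: dist_real_def diff_divide_distrib[symmetric])
      finally show ?thesis
        unfolding v_def using N(2)[OF n inQ inQ] that by simp
    qed
    have cell: "d (v i j) (v i (Suc j)) - d (v (Suc i) j) (v (Suc i) (Suc j)) =
        d (v i j) (v (Suc i) j) - d (v i (Suc j)) (v (Suc i) (Suc j))" if "i < n" "j < n" for i j
    proof -
      have "v i j \<in> H ` Q" unfolding v_def using inQ that by auto
      note add = e(2)[OF this close close close]
      show ?thesis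
        using add[of i j i "Suc j" "Suc i" "Suc j"] add[of i j "Suc i" j "Suc i" "Suc j"] that by simp
    qed
    have refl: "d (v i j) (v i j) = 0" if "i \<le> n" "j \<le> n" for i j
    proof -
      have "v i j \<in> H ` Q" unfolding v_def using inQ that by auto
      from e(2)[OF this, of "v i j" "v i j" "v i j"] e(1) show ?thesis by simp
    qed
    define R where "R = (\<lambda>i. \<Sum>j<n. d (v i j) (v i (Suc j)))"
    have step: "R i = R (Suc i)" if i: "i < n" for i
    proof -
      have "R i - R (Suc i) = (\<Sum>j<n. d (v i j) (v (Suc i) j) - d (v i (Suc j)) (v (Suc i) (Suc j)))"
        unfolding R_def sum_subtractf[symmetric] using i cell by (intro sum.cong) auto
      also have "\<dots> = d (v i 0) (v (Suc i) 0) - d (v i n) (v (Suc i) n)"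
        by (rule sum_lessThan_telescope')
      finally have "R i - R (Suc i) = d (v i 0) (v (Suc i) 0) - d (v i n) (v (Suc i) n)" .
      moreover have "v (Suc i) 0 = v i 0" "v (Suc i) n = v i n"
        using ends i n0 by (auto simp: v_def pathstart_def pathfinish_def)
      ultimately show ?thesis using refl i by simp
    qed
    have const: "R i = R 0" if "i \<le> n" for i
      using that by (induction i) (simp_all add: step[symmetric])
    have "R n = R 0" by (rule const) simp
    moreover have "R 0 = chain_sum d n p"
      unfolding R_def chain_sum_def v_def using n0 by (intro sum.cong) (auto simp: H0)
    moreover have "R n = chain_sum d n q"
      unfolding R_def chain_sum_def v_def using n0 by (intro sum.cong) (auto simp: H1)
    ultimately show ?thesis by simp
  qed
  with N show ?thesis by blast
qed

lemma chain_sum_within: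
  assumes V: "\<And>a b c. a \<in> V \<Longrightarrow> b \<in> V \<Longrightarrow> c \<in> V \<Longrightarrow> d a b + d b c = d a c"
    and p: "path_image p \<subseteq> V" and n: "n > 0"
  shows "chain_sum d n p = d (pathstart p) (pathfinish p)"
proof -
  have pV: "p (real i / real n) \<in> V" if "i \<le> n" for i
    using p that n by (auto simp: path_image_def)
  have p0: "p 0 \<in> V" using pV[of 0] by simp
  have "(\<Sum>i<m. d (p (real i / real n)) (p (real (Suc i) / real n))) = d (p 0) (p (real m / real n))"
    if "m \<le> n" for m
    using that
  proof (induction m)
    case 0
    then show ?case using V[OF p0 p0 p0] by simp
  next
    case (Suc m)
    then show ?case using V[OF p0 pV[of m] pV[of "Suc m"]] by simp
  qed
  from this[of n] show ?thesis using n by (simp add: chain_sum_def pathstart_def pathfinish_def)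
qed

text \<open>
Each step of a fine partition and its two halves lie in a ball where \<open>d\<close> is additive.
\<close>

lemma chain_sum_double:
  assumes d: "locally_additive_on U d" and p: "path p" "path_image p \<subseteq> U"
  shows "\<exists>N>0. \<forall>n\<ge>N. chain_sum d (2 * n) p = chain_sum d n p"
proof -
  have cp: "continuous_on {0..1} p" using p by (simp add: path_def)
  obtain e where e: "e > 0" "\<And>x a b c. x \<in> path_image p \<Longrightarrow> a \<in> ball x e \<Longrightarrow> b \<in> ball x e \<Longrightarrow>
      c \<in> ball x e \<Longrightarrow> d a b + d b c = d a c"
    using locally_additive_uniform[OF d compact_path_image[OF p(1)] p(2)] by metis
  obtain N where N: "N > 0" "\<And>n x y. n \<ge> N \<Longrightarrow> x \<in> {0..1} \<Longrightarrow> y \<in> {0..1} \<Longrightarrow> dist x y \<le> 2 / real n \<Longrightarrow> dist (p x) (p y) < e"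
    using grid_points_close[OF compact_Icc cp e(1)] by metis
  have "chain_sum d (2 * n) p = chain_sum d n p" if n: "n \<ge> N" for n
  proof -
    have n0: "n > 0" using n N by simp
    define x where "x = (\<lambda>i. real i / real (2 * n))"
    have x01: "x i \<in> {0..1}" if "i \<le> 2 * n" for i
      using that n0 by (auto simp: x_def divide_simps)
    have dist_x: "dist (x i) (x j) \<le> 2 / real n" if "i \<le> j" "j \<le> i + 2" for i j
      using that n0 by (auto simp: x_def dist_real_def divide_simps)
    have double: "(\<Sum>i<2 * m. f i) = (\<Sum>i<m. f (2 * i) + f (Suc (2 * i)))" for m and f :: "nat \<Rightarrow> real"
      by (induction m) auto
    have "chain_sum d (2 * n) p = (\<Sum>i<2*n. d (p (x i)) (p (x (Suc i))))"
      by (simp only: chain_sum_def x_def)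
    also have "\<dots> = (\<Sum>i<n. d (p (x (2 * i))) (p (x (Suc (2 * i)))) +
        d (p (x (Suc (2 * i)))) (p (x (Suc (Suc (2 * i))))))"
      by (rule double)
    also have "\<dots> = (\<Sum>i<n. d (p (x (2 * i))) (p (x (Suc (Suc (2 * i))))))"
    proof (rule sum.cong[OF refl])
      fix i assume i: "i \<in> {..<n}"
      show "d (p (x (2 * i))) (p (x (Suc (2 * i)))) + d (p (x (Suc (2 * i)))) (p (x (Suc (Suc (2 * i)))))
          = d (p (x (2 * i))) (p (x (Suc (Suc (2 * i)))))"
      proof (rule e(2)[of "p (x (2 * i))"])
        show "p (x (2 * i)) \<in> path_image p" using x01 i by (auto simp: path_image_def)
        show "p (x (2 * i)) \<in> ball (p (x (2 * i))) e" using e by simp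
        show "p (x (Suc (2 * i))) \<in> ball (p (x (2 * i))) e"
          using i by (auto intro!: N(2)[OF n] x01 dist_x)
        show "p (x (Suc (Suc (2 * i)))) \<in> ball (p (x (2 * i))) e"
          using i by (auto intro!: N(2)[OF n] x01 dist_x)
      qed
    qed
    also have "\<dots> = chain_sum d n p"
    proof -
      have "x (2 * i) = real i / real n" "x (Suc (Suc (2 * i))) = real (Suc i) / real n" for i
        using n0 by (simp_all add: x_def field_simps)
      then show ?thesis by (simp only: chain_sum_def)
    qed
    finally show ?thesis .
  qed
  with N show ?thesis by blast
qed

lemma eventually_dyadic:
  assumes "\<exists>N>0. \<forall>n\<ge>N. P n"
  shows "\<forall>\<^sub>F k in sequentially. P (2 ^ k :: nat)"
proof -
  obtain N where N: "\<forall>n\<ge>N. P n" using assms by blast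
  have "P (2 ^ k)" if "k \<ge> N" for k
  proof -
    have "k < 2 ^ k" by (rule less_exp)
    then have "N \<le> 2 ^ k" using that by linarith
    then show ?thesis using N by blast
  qed
  then show ?thesis by (auto simp: eventually_sequentially)
qed

lemma chain_sum_eventually_path_sum:
  assumes d: "locally_additive_on U d" and p: "path p" "path_image p \<subseteq> U"
  shows "\<forall>\<^sub>F k in sequentially. chain_sum d (2 ^ k) p = path_sum d p"
proof -
  have "\<forall>\<^sub>F k in sequentially. chain_sum d (2 * 2 ^ k) p = chain_sum d (2 ^ k) p"
    using eventually_dyadic[OF chain_sum_double[OF assms]] .
  then obtain N where N: "\<And>k. k \<ge> N \<Longrightarrow> chain_sum d (2 * 2 ^ k) p = chain_sum d (2 ^ k) p"
    unfolding eventually_sequentially by blast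
  have "chain_sum d (2 ^ k) p = chain_sum d (2 ^ N) p" if "k \<ge> N" for k
    using that by (induction k rule: dec_induct) (use N in auto)
  then have ev: "\<forall>\<^sub>F k in sequentially. chain_sum d (2 ^ k) p = chain_sum d (2 ^ N) p"
    unfolding eventually_sequentially by blast
  then have "path_sum d p = chain_sum d (2 ^ N) p"
    unfolding path_sum_def by (intro limI tendsto_eventually)
  with ev show ?thesis by simp
qed

lemma path_sum_unique:
  assumes "locally_additive_on U d" "path p" "path_image p \<subseteq> U"
    and "\<forall>\<^sub>F k in sequentially. chain_sum d (2 ^ k) p = c"
  shows "path_sum d p = c"
proof -
  have "\<forall>\<^sub>F k in sequentially. path_sum d p = c"
    using chain_sum_eventually_path_sum[OF assms(1-3)] assms(4) by eventually_elim simp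
  then show ?thesis by simp
qed

lemma chain_sum_join:
  assumes "pathfinish p = pathstart q" "n > 0"
  shows "chain_sum d (2 * n) (p +++ q) = chain_sum d n p + chain_sum d n q"
proof -
  define r where "r = p +++ q"
  have left: "r (real i / real (2 * n)) = p (real i / real n)" if "i \<le> n" for i
    using that assms(2) by (auto simp: r_def joinpaths_def divide_simps)
  have right: "r (real (n + i) / real (2 * n)) = q (real i / real n)" for i
  proof (cases "i = 0")
    case True
    then show ?thesis
      using left[of n] assms by (simp add: pathstart_def pathfinish_def)
  next
    case False
    have "2 * (real (n + i) / real (2 * n)) - 1 = real i / real n"
      using assms(2) by (simp add: field_simps)
    moreover have "\<not> real (n + i) / real (2 * n) \<le> 1 / 2"
      using False assms(2) by (simp add: field_simps)
    ultimately show ?thesis by (simp only: r_def joinpaths_def if_False)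
  qed
  have split: "(\<Sum>i<n + m. f i) = (\<Sum>i<n. f i) + (\<Sum>i<m. f (n + i))" for m and f :: "nat \<Rightarrow> real"
    by (induction m) auto
  have "chain_sum d (2 * n) r = (\<Sum>i<n + n. d (r (real i / real (2 * n))) (r (real (Suc i) / real (2 * n))))"
    by (simp only: chain_sum_def mult_2)
  also have "\<dots> = (\<Sum>i<n. d (r (real i / real (2 * n))) (r (real (Suc i) / real (2 * n))))
      + (\<Sum>i<n. d (r (real (n + i) / real (2 * n))) (r (real (n + Suc i) / real (2 * n))))"
    using split[where m = n] by simp
  also have "\<dots> = chain_sum d n p + chain_sum d n q"
    unfolding right chain_sum_def by (intro arg_cong2[where f="(+)"] sum.cong refl) (use left in \<open>auto simp del: of_nat_Suc\<close>)
  finally show ?thesis unfolding r_def .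
qed

lemma path_sum_join:
  assumes d: "locally_additive_on U d" and p: "path p" "path_image p \<subseteq> U"
    and q: "path q" "path_image q \<subseteq> U" and pq: "pathfinish p = pathstart q"
  shows "path_sum d (p +++ q) = path_sum d p + path_sum d q"
proof (rule path_sum_unique[OF d])
  show "path (p +++ q)" using p q pq by simp
  show "path_image (p +++ q) \<subseteq> U" using p q by (simp add: subset_path_image_join)
  have "\<forall>\<^sub>F k in sequentially. chain_sum d (2 ^ Suc k) (p +++ q) = path_sum d p + path_sum d q"
    using chain_sum_eventually_path_sum[OF d p] chain_sum_eventually_path_sum[OF d q]
    by eventually_elim (simp add: chain_sum_join[OF pq])
  then show "\<forall>\<^sub>F k in sequentially. chain_sum d (2 ^ k) (p +++ q) = path_sum d p + path_sum d q"
    by (rule eventually_sequentially_Suc[THEN iffD1])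
qed

lemma path_sum_homotopic:
  assumes d: "locally_additive_on U d" and hom: "homotopic_paths U p q"
  shows "path_sum d p = path_sum d q"
proof (rule path_sum_unique[OF d])
  show "path p" "path_image p \<subseteq> U"
    using hom homotopic_paths_imp_path homotopic_paths_imp_subset by blast+
  have "path q" "path_image q \<subseteq> U"
    using hom homotopic_paths_imp_path homotopic_paths_imp_subset by blast+
  from chain_sum_eventually_path_sum[OF d this] eventually_dyadic[OF chain_sum_homotopic[OF assms]]
  show "\<forall>\<^sub>F k in sequentially. chain_sum d (2 ^ k) p = path_sum d q"
    by eventually_elim simp
qed

text \<open>
The potential is the sum along any path from a base point; all such paths are homotopic. Its
increment within a small ball is computed by prolonging a path with a segment of that ball.
\<close>

theorem locally_additive_potential:
  fixes U :: "'a::real_normed_vector set"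
  assumes d: "locally_additive_on U d" and U: "simply_connected U"
  obtains h where "\<And>x. x \<in> U \<Longrightarrow> \<exists>e>0. ball x e \<subseteq> U \<and> (\<forall>a\<in>ball x e. \<forall>b\<in>ball x e. d a b = h b - h a)"
proof (cases "U = {}")
  case False
  then obtain x0 where x0: "x0 \<in> U" by blast
  have "\<forall>w\<in>U. \<exists>g. path g \<and> path_image g \<subseteq> U \<and> pathstart g = x0 \<and> pathfinish g = w"
    using simply_connected_imp_path_connected[OF U] x0 unfolding path_connected_def by blast
  then obtain g where "\<forall>w\<in>U. path (g w) \<and> path_image (g w) \<subseteq> U \<and>
      pathstart (g w) = x0 \<and> pathfinish (g w) = w"
    by (rule bchoice[THEN exE])
  then have g: "path (g w)" "path_image (g w) \<subseteq> U" "pathstart (g w) = x0" "pathfinish (g w) = w"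
    if "w \<in> U" for w using that by blast+
  define h where "h = (\<lambda>w. path_sum d (g w))"
  have "\<exists>e>0. ball x e \<subseteq> U \<and> (\<forall>a\<in>ball x e. \<forall>b\<in>ball x e. d a b = h b - h a)" if x: "x \<in> U" for x
  proof -
    obtain e where e: "e > 0" "ball x e \<subseteq> U"
      and add: "\<And>a b c. a \<in> ball x e \<Longrightarrow> b \<in> ball x e \<Longrightarrow> c \<in> ball x e \<Longrightarrow> d a b + d b c = d a c"
      using d x unfolding locally_additive_on_def by blast
    have "d a b = h b - h a" if ab: "a \<in> ball x e" "b \<in> ball x e" for a b
    proof -
      have abU: "a \<in> U" "b \<in> U" using ab e by auto
      have seg: "path_image (linepath a b) \<subseteq> ball x e"
        using ab by (simp add: closed_segment_subset)
      have "path_sum d (linepath a b) = d a b"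
      proof (rule path_sum_unique[OF d])
        show "path_image (linepath a b) \<subseteq> U" using seg e by blast
        show "\<forall>\<^sub>F k in sequentially. chain_sum d (2 ^ k) (linepath a b) = d a b"
          using chain_sum_within[of "ball x e" d "linepath a b", OF add seg] by simp
      qed simp
      moreover have "path_sum d (g a +++ linepath a b) = h a + path_sum d (linepath a b)"
        unfolding h_def using g[OF abU(1)] seg e by (intro path_sum_join[OF d]) auto
      moreover have "homotopic_paths U (g a +++ linepath a b) (g b)"
      proof -
        have "path_image (g a +++ linepath a b) \<subseteq> U"
          using g[OF abU(1)] seg e by (intro subset_path_image_join) auto
        then show ?thesis
          using U g[OF abU(1)] g[OF abU(2)]
          unfolding simply_connected_eq_homotopic_paths by simp
      qed
      then have "path_sum d (g a +++ linepath a b) = h b"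
        unfolding h_def by (rule path_sum_homotopic[OF d])
      ultimately show ?thesis by simp
    qed
    with e show ?thesis by blast
  qed
  then show thesis by (rule that)
qed (use that in simp)

section \<open>Closed vector fields and their line integrals\<close>

lemma gderiv_at_local:
  assumes "GDERIV h w :> g" "e > 0" "\<And>y. y \<in> ball w e \<Longrightarrow> k y = h y + c"
  shows "GDERIV k w :> g"
proof -
  have "((\<lambda>y. h y + c) has_derivative (\<lambda>v. v \<bullet> g)) (at w)"
    using assms(1) unfolding gderiv_def by (intro has_derivative_add_const)
  then show ?thesis
    unfolding gderiv_def
    by (rule has_derivative_transform_within_open[of _ _ _ _ "ball w e"]) (use assms in auto)
qed

text \<open>
On a ball, the integral over segments is the increment of a potential. Hence it is locally
additive, and the global function supplied by simple connectedness differs from each potential on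
a ball by a constant.
\<close>

theorem potential_of_closed_field_on_simply_connected:
  fixes G :: "'a::euclidean_space \<Rightarrow> 'a"
  assumes U: "open U" "simply_connected U"
    and DG: "\<And>x. x \<in> U \<Longrightarrow> (G has_derivative D x) (at x)"
    and sym: "\<And>x u v. x \<in> U \<Longrightarrow> D x u \<bullet> v = D x v \<bullet> u"
  shows "\<exists>h. \<forall>w\<in>U. GDERIV h w :> G w"
proof -
  have loc: "\<exists>k. (\<forall>w\<in>ball x e. GDERIV k w :> G w) \<and>
      (\<forall>a\<in>ball x e. \<forall>b\<in>ball x e. segment_integral G a b = k b - k a)" if "ball x e \<subseteq> U" for x e
  proof -
    have "\<exists>k. \<forall>w\<in>ball x e. GDERIV k w :> G w"
      using DG sym that by (intro potential_of_closed_field_on_convex[of _ G D]) auto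
    then obtain k where k: "\<And>w. w \<in> ball x e \<Longrightarrow> GDERIV k w :> G w" by blast
    moreover have "segment_integral G a b = k b - k a" if "a \<in> ball x e" "b \<in> ball x e" for a b
      using closed_segment_subset[OF that convex_ball] k by (intro segment_integral_gradient) blast
    ultimately show ?thesis by blast
  qed
  have "locally_additive_on U (segment_integral G)"
    unfolding locally_additive_on_def
  proof
    fix x assume "x \<in> U"
    then obtain e where e: "e > 0" "ball x e \<subseteq> U" using U(1) open_contains_ball by blast
    from loc[OF e(2)] have "\<forall>a\<in>ball x e. \<forall>b\<in>ball x e. \<forall>c\<in>ball x e.
        segment_integral G a b + segment_integral G b c = segment_integral G a c"
      by force
    with e show "\<exists>e>0. ball x e \<subseteq> U \<and> (\<forall>a\<in>ball x e. \<forall>b\<in>ball x e. \<forall>c\<in>ball x e.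
        segment_integral G a b + segment_integral G b c = segment_integral G a c)" by blast
  qed
  then obtain h where h: "\<And>x. x \<in> U \<Longrightarrow> \<exists>e>0. ball x e \<subseteq> U \<and>
      (\<forall>a\<in>ball x e. \<forall>b\<in>ball x e. segment_integral G a b = h b - h a)"
    using locally_additive_potential[OF _ U(2)] by blast
  have "GDERIV h w :> G w" if w: "w \<in> U" for w
  proof -
    obtain e where e: "e > 0" "ball w e \<subseteq> U"
      and he: "\<And>a b. a \<in> ball w e \<Longrightarrow> b \<in> ball w e \<Longrightarrow> segment_integral G a b = h b - h a"
      using h[OF w] by blast
    obtain k where k: "GDERIV k w :> G w"
      and ke: "\<And>a b. a \<in> ball w e \<Longrightarrow> b \<in> ball w e \<Longrightarrow> segment_integral G a b = k b - k a"
      using loc[OF e(2)] e(1) by force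
    have "h y = k y + (h w - k w)" if "y \<in> ball w e" for y
      using he[of w y] ke[of w y] that e(1) by simp
    then show ?thesis by (rule gderiv_at_local[OF k e(1)])
  qed
  then show ?thesis by blast
qed

text \<open>
A curve that is merely differentiable may have a discontinuous and unbounded derivative, so
integrability does not come from continuity. Where \<open>G\<close> has a potential \<open>h\<close> near the curve, the
integrand is the derivative of \<open>h \<circ> \<gamma>\<close>, which is always Henstock-Kurzweil integrable; subintervals
on which this applies cover \<open>[0, a]\<close>.
\<close>

lemma line_integrand_integrable:
  assumes V: "open V" "\<gamma> ` {0..a} \<subseteq> V" and \<gamma>: "\<gamma> differentiable_on {0..a}"
    and loc: "\<And>x e. ball x e \<subseteq> V \<Longrightarrow> \<exists>h. \<forall>w\<in>ball x e. GDERIV h w :> G w"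
  shows "line_integrand G \<gamma> a integrable_on {0..a}"
proof (cases "0 < a")
  case False
  then show ?thesis
    by (metis box_real(2) content_real_eq_0 integrable_on_null linorder_not_less)
next
  case a: True
  have der: "(\<gamma> has_vector_derivative vector_derivative \<gamma> (at \<tau> within {0..a})) (at \<tau> within {0..a})"
    if "\<tau> \<in> {0..a}" for \<tau>
    using \<gamma> that by (simp add: differentiable_on_def vector_derivative_works)
  have c\<gamma>: "continuous_on {0..a} \<gamma>" using \<gamma> by (rule differentiable_imp_continuous_on)
  have "line_integrand G \<gamma> a integrable_on cbox 0 a"
  proof (rule integrable_on_little_subintervals, intro ballI)
    fix t assume "t \<in> cbox 0 a"
    then have t: "t \<in> {0..a}" by simp
    then obtain e where e: "e > 0" "ball (\<gamma> t) e \<subseteq> V" using V open_contains_ball by blast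
    then obtain h where h: "\<And>w. w \<in> ball (\<gamma> t) e \<Longrightarrow> GDERIV h w :> G w" using loc by blast
    obtain d where d: "d > 0" "\<And>\<tau>. \<tau> \<in> {0..a} \<Longrightarrow> dist \<tau> t < d \<Longrightarrow> dist (\<gamma> \<tau>) (\<gamma> t) < e"
      using c\<gamma> t e(1) unfolding continuous_on_iff by metis
    have "line_integrand G \<gamma> a integrable_on cbox u v"
      if uv: "t \<in> cbox u v" "cbox u v \<subseteq> ball t d" "cbox u v \<subseteq> cbox 0 a" for u v
    proof -
      have sub: "{u..v} \<subseteq> {0..a}" using uv(3) by simp
      have "(line_integrand G \<gamma> a has_integral (h (\<gamma> v) - h (\<gamma> u))) {u..v}"
      proof (rule fundamental_theorem_of_calculus)
        show "u \<le> v" using uv by auto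
        fix \<tau> assume \<tau>: "\<tau> \<in> {u..v}"
        then have \<tau>a: "\<tau> \<in> {0..a}" and "dist \<tau> t < d"
          using uv by (auto simp: subset_iff dist_commute)
        then have "\<gamma> \<tau> \<in> ball (\<gamma> t) e" using d(2) by (simp add: dist_commute)
        then have "(h has_derivative (\<lambda>v. v \<bullet> G (\<gamma> \<tau>))) (at (\<gamma> \<tau>) within \<gamma> ` {u..v})"
          using h unfolding gderiv_def by (blast intro: has_derivative_at_withinI)
        moreover have "(\<gamma> has_vector_derivative vector_derivative \<gamma> (at \<tau> within {0..a})) (at \<tau> within {u..v})"
          by (rule has_vector_derivative_within_subset[OF der[OF \<tau>a] sub])
        ultimately have "((h \<circ> \<gamma>) has_vector_derivative
            vector_derivative \<gamma> (at \<tau> within {0..a}) \<bullet> G (\<gamma> \<tau>)) (at \<tau> within {u..v})"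
          by (rule vector_derivative_diff_chain_within[rotated])
        then show "((\<lambda>\<tau>. h (\<gamma> \<tau>)) has_vector_derivative line_integrand G \<gamma> a \<tau>) (at \<tau> within {u..v})"
          by (simp add: o_def line_integrand_def inner_commute)
      qed
      then show ?thesis by (auto simp: integrable_on_def)
    qed
    with d(1) show "\<exists>d>0. \<forall>u v. t \<in> cbox u v \<and> cbox u v \<subseteq> ball t d \<and> cbox u v \<subseteq> cbox 0 a \<longrightarrow>
        line_integrand G \<gamma> a integrable_on cbox u v" by blast
  qed
  then show ?thesis by simp
qed

lemma partial_derivs_of_gradient:
  assumes "GDERIV h w :> (g :: real ^ 3)"
  shows "((\<lambda>\<tau>. h (w + \<tau> *\<^sub>R axis k 1)) has_real_derivative g $ k) (at 0)"
proof -
  have "((\<lambda>\<tau>::real. w + \<tau> *\<^sub>R axis k 1) has_derivative (\<lambda>\<tau>. \<tau> *\<^sub>R axis k 1)) (at 0)"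
    by (auto intro!: derivative_eq_intros)
  moreover have "(h has_derivative (\<lambda>v. v \<bullet> g)) (at (w + 0 *\<^sub>R axis k 1))"
    using assms by (simp add: gderiv_def)
  ultimately have "((\<lambda>\<tau>. h (w + \<tau> *\<^sub>R axis k 1)) has_derivative (\<lambda>\<tau>. (\<tau> *\<^sub>R axis k 1) \<bullet> g)) (at 0)"
    by (rule has_derivative_compose)
  then show ?thesis
    by (simp add: has_field_derivative_def inner_axis' mult.commute[of _ "g $ k"])
qed

section \<open>The algebra\<close>

locale cubic_algebra =
  fixes r s t :: 3 and p1 p2 :: real
  assumes indices: "{r, s, t} = {1, 2, 3}"
begin

abbreviation alg_times :: "real ^ 3 \<Rightarrow> real ^ 3 \<Rightarrow> real ^ 3" (infixl "\<star>" 70) where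
  "x \<star> y \<equiv> alg_mult r s t p1 p2 x y"

abbreviation "regular \<equiv> alg_regular r s t p1 p2"

lemma UNIV_indices: "UNIV = {r, s, t}"
  using indices by (simp add: UNIV_3)

lemma distinct_indices: "r \<noteq> s" "r \<noteq> t" "s \<noteq> t" "s \<noteq> r" "t \<noteq> r" "t \<noteq> s"
proof -
  have "card {r, s, t} = 3" unfolding UNIV_indices[symmetric] by simp
  then show "r \<noteq> s" "r \<noteq> t" "s \<noteq> t" "s \<noteq> r" "t \<noteq> r" "t \<noteq> s"
    by (auto simp: card_insert_if split: if_splits)
qed

lemma sum_indices: "(\<Sum>i\<in>UNIV. f i) = f r + f s + (f t :: 'b::comm_monoid_add)"
  unfolding UNIV_indices using distinct_indices by (simp add: add.assoc)

lemma index_cases: obtains "i = r" | "i = s" | "i = t"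
  using UNIV_indices by blast

lemma vec_eq_indices: "x = y \<longleftrightarrow> x $ r = y $ r \<and> x $ s = y $ s \<and> x $ t = (y $ t :: real)"
  unfolding vec_eq_iff using UNIV_indices by auto

lemma inner_indices: "x \<bullet> y = x $ r * y $ r + x $ s * y $ s + x $ t * (y $ t :: real)"
  by (simp add: inner_vec_def sum_indices)

lemma axis_nth: "axis i (1::real) $ j = (if i = j then 1 else 0)"
  by (simp add: axis_def)

lemma alg_mult_components:
  "(x \<star> y) $ r = x $ r * y $ r"
  "(x \<star> y) $ s = x $ s * y $ s + p1 * (x $ t * y $ t)"
  "(x \<star> y) $ t = x $ s * y $ t + x $ t * y $ s + p2 * (x $ t * y $ t)"
  using distinct_indices
  by (simp_all add: alg_mult_def sum_indices basis_prod_def axis_nth)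

lemma unit_components:
  "alg_unit r s $ r = 1" "alg_unit r s $ s = 1" "alg_unit r s $ t = 0"
  using distinct_indices by (simp_all add: alg_unit_def axis_nth)

lemma alg_mult_commute: "x \<star> y = y \<star> x"
  by (simp add: vec_eq_indices alg_mult_components algebra_simps)

lemma alg_mult_assoc:
  "x \<star> y \<star> z = x \<star> (y \<star> z)"
  by (simp add: vec_eq_indices alg_mult_components algebra_simps)

lemma alg_mult_unit: "alg_unit r s \<star> x = x"
  by (simp add: vec_eq_indices alg_mult_components unit_components)

lemma bounded_bilinear_alg_mult: "bounded_bilinear (\<star>)"
proof -
  have "bilinear (\<star>)"
    unfolding bilinear_def
    by (auto intro!: linearI simp: vec_eq_indices alg_mult_components algebra_simps)
  then show ?thesis by (simp add: bilinear_conv_bounded_bilinear)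
qed

text \<open>
The determinant of multiplication by \<open>x\<close> on the span of \<open>e\<^sub>s\<close> and \<open>e\<^sub>t\<close>; therefore it is
multiplicative, and \<open>x\<close> is regular exactly if it and the component \<open>x $ r\<close> are nonzero.
\<close>

definition norm_form :: "real ^ 3 \<Rightarrow> real" where
  "norm_form x = (x $ s)\<^sup>2 + p2 * x $ s * x $ t - p1 * (x $ t)\<^sup>2"

lemma norm_form_mult:
  "norm_form (x \<star> y) = norm_form x * norm_form y"
  unfolding norm_form_def alg_mult_components by (simp add: power2_eq_square algebra_simps)

text \<open>
The inverse by Cramer's rule. An explicit formula, total by the convention \<open>1 / 0 = 0\<close>, is easier
to differentiate than the description of the inverse as the solution of an equation.
\<close>

definition reciprocal :: "real ^ 3 \<Rightarrow> real ^ 3" where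
  "reciprocal x = (1 / x $ r) *\<^sub>R axis r 1
     + ((x $ s + p2 * x $ t) / norm_form x) *\<^sub>R axis s 1
     + (- x $ t / norm_form x) *\<^sub>R axis t 1"

lemma reciprocal_components:
  "reciprocal x $ r = 1 / x $ r"
  "reciprocal x $ s = (x $ s + p2 * x $ t) / norm_form x"
  "reciprocal x $ t = - x $ t / norm_form x"
  using distinct_indices by (simp_all add: reciprocal_def axis_nth)

lemma mult_reciprocal:
  assumes "x $ r \<noteq> 0" "norm_form x \<noteq> 0"
  shows "x \<star> reciprocal x = alg_unit r s"
  using assms
  by (simp add: vec_eq_indices alg_mult_components unit_components reciprocal_components field_simps)
    (simp add: norm_form_def power2_eq_square algebra_simps)

lemma alg_regular_iff: "x \<in> regular \<longleftrightarrow> x $ r \<noteq> 0 \<and> norm_form x \<noteq> 0"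
proof
  assume "x \<in> regular"
  then obtain y where y: "x \<star> y = alg_unit r s" by (auto simp: alg_regular_def)
  have "norm_form x * norm_form y = 1"
    unfolding norm_form_mult[symmetric] y by (simp add: norm_form_def unit_components)
  moreover have "x $ r * y $ r = 1"
    unfolding alg_mult_components(1)[symmetric] y by (simp add: unit_components)
  ultimately show "x $ r \<noteq> 0 \<and> norm_form x \<noteq> 0" by auto
qed (use mult_reciprocal in \<open>auto simp: alg_regular_def\<close>)

lemma alg_inverse_eq:
  assumes "x \<in> regular"
  shows "alg_inverse r s t p1 p2 x = reciprocal x"
  unfolding alg_inverse_def
proof (rule the_equality)
  show one: "x \<star> reciprocal x = alg_unit r s"
    using assms by (simp add: alg_regular_iff mult_reciprocal)
  fix y assume "x \<star> y = alg_unit r s"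
  then show "y = reciprocal x"
    using one by (metis alg_mult_assoc alg_mult_commute alg_mult_unit)
qed

end

context cubic_algebra begin

lemma alg_times_left_commute: "x \<star> (y \<star> z) = y \<star> (x \<star> z)"
  by (simp only: alg_mult_assoc[symmetric] alg_mult_commute[of x y])

lemma open_regular: "open regular"
proof -
  have "regular = {x. x $ r \<noteq> 0} \<inter> {x. norm_form x \<noteq> 0}"
    by (auto simp: alg_regular_iff)
  moreover have "open {x :: real ^ 3. x $ r \<noteq> 0}" "open {x. norm_form x \<noteq> 0}"
    unfolding norm_form_def by (intro open_Collect_neq continuous_intros)+
  ultimately show ?thesis by auto
qed

lemma reciprocal_differentiable:
  assumes "x \<in> regular"
  shows "reciprocal differentiable (at x)"
proof -
  have nth: "(\<lambda>x. x $ i) differentiable (at x)" for i :: 3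
    by (intro linear_imp_differentiable bounded_linear.linear bounded_linear_vec_nth)
  have N: "norm_form differentiable (at x)"
    unfolding norm_form_def[abs_def] using nth by (auto intro!: derivative_intros)
  have "x $ r \<noteq> 0" "norm_form x \<noteq> 0" using assms by (auto simp: alg_regular_iff)
  then show ?thesis
    unfolding reciprocal_def[abs_def] using nth N
    by (auto intro!: derivative_intros)
qed

text \<open>
The inverse is differentiable by its formula; its derivative \<open>D\<close> is then found by differentiating
\<open>y \<star> reciprocal y = e\<close>, as for \<open>1 / y\<close> in one variable.
\<close>

lemma reciprocal_has_derivative:
  assumes x: "x \<in> regular"
  shows "(reciprocal has_derivative (\<lambda>\<xi>. - (reciprocal x \<star> reciprocal x \<star> \<xi>))) (at x)"
proof -
  obtain D where D: "(reciprocal has_derivative D) (at x)"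
    using reciprocal_differentiable[OF x] unfolding differentiable_def by blast
  have "((\<lambda>y. y \<star> reciprocal y) has_derivative (\<lambda>\<xi>. x \<star> D \<xi> + \<xi> \<star> reciprocal x)) (at x)"
    by (rule bounded_bilinear.FDERIV[OF bounded_bilinear_alg_mult has_derivative_ident D])
  moreover have "((\<lambda>y. y \<star> reciprocal y) has_derivative (\<lambda>_. 0)) (at x)"
    by (rule has_derivative_transform_within_open[OF has_derivative_const open_regular x])
      (simp add: mult_reciprocal alg_regular_iff)
  ultimately have "(\<lambda>\<xi>. x \<star> D \<xi> + \<xi> \<star> reciprocal x) = (\<lambda>_. 0)"
    by (rule has_derivative_unique)
  then have prod: "x \<star> D \<xi> + \<xi> \<star> reciprocal x = 0" for \<xi>
    by (rule fun_cong)
  interpret bounded_bilinear "(\<star>)" by (rule bounded_bilinear_alg_mult)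
  have "D \<xi> = - (reciprocal x \<star> reciprocal x \<star> \<xi>)" for \<xi>
  proof -
    have "reciprocal x \<star> x = alg_unit r s"
      using x by (subst alg_mult_commute) (simp add: mult_reciprocal alg_regular_iff)
    then have "D \<xi> = reciprocal x \<star> (x \<star> D \<xi>)"
      by (simp add: alg_mult_assoc[symmetric] alg_mult_unit)
    also have "x \<star> D \<xi> = - (\<xi> \<star> reciprocal x)"
      using prod[of \<xi>] eq_neg_iff_add_eq_0 by blast
    also have "\<dots> = - (reciprocal x \<star> \<xi>)"
      by (subst alg_mult_commute) (rule refl)
    finally show ?thesis by (simp only: minus_right alg_mult_assoc)
  qed
  then have "D = (\<lambda>\<xi>. - (reciprocal x \<star> reciprocal x \<star> \<xi>))" by (rule ext)
  with D show ?thesis by simp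
qed

text \<open>
The \<open>i\<close>-th row of the matrix of multiplication by \<open>x\<close>. The fields \<open>G\<^sub>i\<close> are the rows
belonging to \<open>x = e / F\<close>.
\<close>

definition coefficient_row :: "3 \<Rightarrow> real ^ 3 \<Rightarrow> real ^ 3" where
  "coefficient_row i x = (\<chi> k. (x \<star> axis k 1) $ i)"

lemma coefficient_row_inner: "coefficient_row i x \<bullet> \<xi> = (x \<star> \<xi>) $ i"
  using distinct_indices
  by (cases i rule: index_cases)
    (simp_all add: coefficient_row_def inner_indices alg_mult_components axis_nth algebra_simps)

lemma bounded_linear_coefficient_row: "bounded_linear (coefficient_row i)"
proof -
  interpret bounded_bilinear "(\<star>)" by (rule bounded_bilinear_alg_mult)
  show ?thesis
    by (intro linear_conv_bounded_linear[THEN iffD1] linearI)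
      (simp_all add: coefficient_row_def vec_eq_iff add_left scaleR_left)
qed

end

section \<open>Algebrizable vector fields\<close>

locale algebrizable_field = cubic_algebra +
  fixes \<Omega> F
  assumes open_domain: "open \<Omega>" and algebrizable: "algebrizable_on r s t p1 p2 \<Omega> F"
begin

abbreviation "regular_part \<equiv> regular_domain r s t p1 p2 \<Omega> F"

lemma has_algebra_derivative: "\<exists>F'. \<forall>w\<in>\<Omega>. (F has_derivative (\<star>) (F' w)) (at w)"
proof -
  obtain F' where F': "\<forall>w\<in>\<Omega>.
      ((\<lambda>\<xi>. norm (F (w + \<xi>) - F w - F' w \<star> \<xi>) / norm \<xi>) \<longlongrightarrow> 0) (at 0)"
    using algebrizable unfolding algebrizable_on_def by (rule exE)
  have "\<forall>w\<in>\<Omega>. (F has_derivative (\<star>) (F' w)) (at w)"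
    using F' bounded_bilinear.bounded_linear_right[OF bounded_bilinear_alg_mult]
    by (simp add: has_derivative_at)
  then show ?thesis by (rule exI[of _ F'])
qed

lemma open_regular_part: "open regular_part"
proof -
  obtain F' where "\<forall>w\<in>\<Omega>. (F has_derivative (\<star>) (F' w)) (at w)"
    using has_algebra_derivative by blast
  then have "continuous_on \<Omega> F"
    by (intro continuous_at_imp_continuous_on) (auto dest: has_derivative_continuous)
  then have "open (\<Omega> \<inter> F -` regular)"
    using continuous_open_preimage open_domain open_regular by blast
  moreover have "regular_part = \<Omega> \<inter> F -` regular" by (auto simp: regular_domain_def)
  ultimately show ?thesis by simp
qed

definition dual_field :: "3 \<Rightarrow> real ^ 3 \<Rightarrow> real ^ 3" where
  "dual_field i w = coefficient_row i (reciprocal (F w))"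

lemma dual_field_inner: "dual_field i w \<bullet> \<xi> = (reciprocal (F w) \<star> \<xi>) $ i"
  by (simp add: dual_field_def coefficient_row_inner)

text \<open>
The chain rule gives \<open>D G\<^sub>i(u) \<bullet> v = - (F\<^sup>-\<^sup>2 F' u v)\<^sub>i\<close>, which is symmetric in \<open>u\<close> and \<open>v\<close>
because the algebra is commutative and associative.
\<close>

lemma dual_field_closed:
  "\<exists>D. (\<forall>w\<in>regular_part. (dual_field i has_derivative D w) (at w)) \<and>
    (\<forall>w u v. D w u \<bullet> v = D w v \<bullet> u)"
proof -
  obtain F' where F': "\<And>w. w \<in> \<Omega> \<Longrightarrow> (F has_derivative (\<star>) (F' w)) (at w)"
    using has_algebra_derivative by blast
  define J where "J = (\<lambda>w. reciprocal (F w))"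
  define D where "D = (\<lambda>w \<xi>. coefficient_row i (- (J w \<star> J w \<star> (F' w \<star> \<xi>))))"
  interpret bounded_bilinear "(\<star>)" by (rule bounded_bilinear_alg_mult)
  show ?thesis
  proof (intro exI[of _ D] conjI ballI allI)
    fix w assume w: "w \<in> regular_part"
    then have "w \<in> \<Omega>" "F w \<in> regular" by (auto simp: regular_domain_def)
    then have "((\<lambda>w. reciprocal (F w)) has_derivative (\<lambda>\<xi>. - (J w \<star> J w \<star> (F' w \<star> \<xi>)))) (at w)"
      using has_derivative_compose[OF F' reciprocal_has_derivative] unfolding J_def by simp
    then show "(dual_field i has_derivative D w) (at w)"
      unfolding dual_field_def[abs_def] D_def
      by (rule bounded_linear.has_derivative[OF bounded_linear_coefficient_row])
  next
    fix w u v
    have "J w \<star> J w \<star> (F' w \<star> u) \<star> v = J w \<star> J w \<star> (F' w \<star> v) \<star> u"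
      by (simp only: alg_mult_assoc alg_mult_commute[of u v])
    then show "D w u \<bullet> v = D w v \<bullet> u"
      by (simp add: D_def coefficient_row_inner minus_left)
  qed
qed

lemma dual_field_potential:
  assumes "open U" "simply_connected U" "U \<subseteq> regular_part"
  shows "\<exists>h. \<forall>w\<in>U. GDERIV h w :> dual_field i w"
proof -
  obtain D where "\<forall>w\<in>regular_part. (dual_field i has_derivative D w) (at w)"
    and "\<forall>w u v. D w u \<bullet> v = D w v \<bullet> u"
    using dual_field_closed by blast
  then show ?thesis
    using assms by (intro potential_of_closed_field_on_simply_connected[of U "dual_field i" D]) auto
qed

lemma dual_field_line_integrable:
  assumes "\<gamma> differentiable_on {0..a}" "\<gamma> ` {0..a} \<subseteq> regular_part"
  shows "line_integrand (dual_field i) \<gamma> a integrable_on {0..a}"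
  by (rule line_integrand_integrable[OF open_regular_part assms(2,1)])
    (intro dual_field_potential open_ball convex_imp_simply_connected convex_ball)

lemma alg_integrand_components:
  assumes "\<gamma> \<tau> \<in> regular_part"
  shows "alg_integrand r s t p1 p2 F \<gamma> a \<tau> $ i = line_integrand (dual_field i) \<gamma> a \<tau>"
  using assms
  by (simp add: alg_integrand_def line_integrand_def dual_field_inner alg_inverse_eq regular_domain_def)

text \<open>
The duality is the identity \<open>(e / F) (e\<^sub>i F) = e\<^sub>i\<close> read in the \<open>j\<close>-th component.
\<close>

lemma dual_field_basis:
  assumes "w \<in> regular_part"
  shows "dual_field j w \<bullet> (axis i 1 \<star> F w) = (if i = j then 1 else 0)"
proof -
  have "reciprocal (F w) \<star> (axis i 1 \<star> F w) = axis i 1 \<star> (F w \<star> reciprocal (F w))"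
    by (subst alg_times_left_commute) (simp only: alg_mult_commute[of "F w"])
  also have "F w \<star> reciprocal (F w) = alg_unit r s"
    using assms by (intro mult_reciprocal) (auto simp: regular_domain_def alg_regular_iff)
  finally show ?thesis
    by (simp add: dual_field_inner alg_mult_commute[of "axis i 1"] alg_mult_unit axis_nth)
qed

lemma dual_field_components:
  "dual_field r w = (1 / F w $ r) *\<^sub>R axis r 1"
  "dual_field s w = ((F w $ s + p2 * F w $ t) / norm_form (F w)) *\<^sub>R axis s 1
     - ((p1 * F w $ t) / norm_form (F w)) *\<^sub>R axis t 1"
  "dual_field t w = ((- F w $ t) / norm_form (F w)) *\<^sub>R axis s 1
     + ((F w $ s) / norm_form (F w)) *\<^sub>R axis t 1"
  using distinct_indices
  by (simp_all add: dual_field_def coefficient_row_def vec_eq_indices alg_mult_components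
      reciprocal_components axis_nth add_divide_distrib)

end

theorem proposition4p2:
  fixes r s t :: 3 and p1 p2 :: real
    and \<Omega> :: "(real ^ 3) set" and F :: "real ^ 3 \<Rightarrow> real ^ 3"
    and E G :: "3 \<Rightarrow> real ^ 3 \<Rightarrow> real ^ 3"
  assumes rst: "{r, s, t} = {1, 2, 3}"
    and open_dom: "open \<Omega>"
    and alg: "algebrizable_on r s t p1 p2 \<Omega> F"
    and E: "\<And>i w. w \<in> \<Omega> \<Longrightarrow> E i w = alg_mult r s t p1 p2 (axis i 1) (F w)"
    and G_r: "\<And>w. w \<in> regular_domain r s t p1 p2 \<Omega> F \<Longrightarrow>
      G r w = (1 / F w $ r) *\<^sub>R axis r 1"
    and G_s: "\<And>w. w \<in> regular_domain r s t p1 p2 \<Omega> F \<Longrightarrow>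
      G s w =
        ((F w $ s + p2 * F w $ t) /
          ((F w $ s)\<^sup>2 + p2 * F w $ s * F w $ t - p1 * (F w $ t)\<^sup>2)) *\<^sub>R axis s 1
        - ((p1 * F w $ t) /
          ((F w $ s)\<^sup>2 + p2 * F w $ s * F w $ t - p1 * (F w $ t)\<^sup>2)) *\<^sub>R axis t 1"
    and G_t: "\<And>w. w \<in> regular_domain r s t p1 p2 \<Omega> F \<Longrightarrow>
      G t w =
        ((- F w $ t) /
          ((F w $ s)\<^sup>2 + p2 * F w $ s * F w $ t - p1 * (F w $ t)\<^sup>2)) *\<^sub>R axis s 1
        + ((F w $ s) /
          ((F w $ s)\<^sup>2 + p2 * F w $ s * F w $ t - p1 * (F w $ t)\<^sup>2)) *\<^sub>R axis t 1"
  shows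
    "(\<forall>w\<in>\<Omega>.
        E r w = F w $ r *\<^sub>R axis r 1 \<and>
        E s w = F w $ s *\<^sub>R axis s 1 + F w $ t *\<^sub>R axis t 1 \<and>
        E t w = (p1 * F w $ t) *\<^sub>R axis s 1 + (F w $ s + p2 * F w $ t) *\<^sub>R axis t 1)
     \<and>
     (\<forall>a \<gamma>. 0 \<le> a \<and> \<gamma> differentiable_on {0..a} \<and>
        \<gamma> ` {0..a} \<subseteq> regular_domain r s t p1 p2 \<Omega> F \<longrightarrow>
        alg_integrand r s t p1 p2 F \<gamma> a integrable_on {0..a} \<and>
        (\<forall>i. line_integrand (G i) \<gamma> a integrable_on {0..a}) \<and>
        integral {0..a} (alg_integrand r s t p1 p2 F \<gamma> a) =
          (\<chi> i. integral {0..a} (line_integrand (G i) \<gamma> a)))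
     \<and>
     (\<forall>U i. open U \<and> simply_connected U \<and> U \<subseteq> regular_domain r s t p1 p2 \<Omega> F \<longrightarrow>
        conservative_on U (G i))
     \<and>
     (\<forall>w\<in>regular_domain r s t p1 p2 \<Omega> F. \<forall>i j. E i w \<bullet> G j w = (if i = j then 1 else 0))
     \<and>
     (\<forall>U i. open U \<and> simply_connected U \<and> U \<subseteq> regular_domain r s t p1 p2 \<Omega> F \<longrightarrow>
        (\<exists>A D. first_antiderivative_on U (G i) A D) \<and>
        (\<forall>A D. first_antiderivative_on U (G i) A D \<longrightarrow>
          (\<exists>B. second_antiderivative_on U (G i) D B \<and> potential_on U (G i) (\<lambda>w. A w + B w))))
     \<and>
     (\<forall>U i j h. open U \<and> U \<subseteq> regular_domain r s t p1 p2 \<Omega> F \<and> i \<noteq> j \<and>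
        potential_on U (G i) h \<longrightarrow>
        first_integral_on U (E j) h)"
proof -
  interpret algebrizable_field r s t p1 p2 \<Omega> F
    using rst open_dom alg by unfold_locales
  have G: "G i w = dual_field i w" if "w \<in> regular_part" for i w
    using G_r[OF that] G_s[OF that] G_t[OF that]
    by (cases i rule: index_cases) (simp_all add: dual_field_components norm_form_def)
  have E_forms: "E r w = F w $ r *\<^sub>R axis r 1"
        "E s w = F w $ s *\<^sub>R axis s 1 + F w $ t *\<^sub>R axis t 1"
        "E t w = (p1 * F w $ t) *\<^sub>R axis s 1 + (F w $ s + p2 * F w $ t) *\<^sub>R axis t 1"
    if "w \<in> \<Omega>" for w
    using E[OF that] distinct_indices by (simp_all add: vec_eq_indices alg_mult_components axis_nth)
  have integrals: "alg_integrand r s t p1 p2 F \<gamma> a integrable_on {0..a}"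
      "\<And>i. line_integrand (G i) \<gamma> a integrable_on {0..a}"
      "integral {0..a} (alg_integrand r s t p1 p2 F \<gamma> a) =
          (\<chi> i. integral {0..a} (line_integrand (G i) \<gamma> a))"
    if \<gamma>: "\<gamma> differentiable_on {0..a}" "\<gamma> ` {0..a} \<subseteq> regular_part" for a \<gamma>
  proof -
    have on_path: "line_integrand (G i) \<gamma> a \<tau> = line_integrand (dual_field i) \<gamma> a \<tau>"
        "line_integrand (G i) \<gamma> a \<tau> = alg_integrand r s t p1 p2 F \<gamma> a \<tau> $ i"
      if "\<tau> \<in> {0..a}" for \<tau> i
    proof -
      have "\<gamma> \<tau> \<in> regular_part" using that \<gamma>(2) by blast
      then show "line_integrand (G i) \<gamma> a \<tau> = line_integrand (dual_field i) \<gamma> a \<tau>"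
          "line_integrand (G i) \<gamma> a \<tau> = alg_integrand r s t p1 p2 F \<gamma> a \<tau> $ i"
        using G alg_integrand_components by (simp_all add: line_integrand_def)
    qed
    show line: "line_integrand (G i) \<gamma> a integrable_on {0..a}" for i
      using integrable_eq[OF dual_field_line_integrable[OF \<gamma>]] on_path(1) by simp
    show int: "alg_integrand r s t p1 p2 F \<gamma> a integrable_on {0..a}"
    proof (rule integrable_componentwise)
      fix b :: "real ^ 3" assume "b \<in> Basis"
      then obtain k where b: "b = axis k 1" by (auto simp: Basis_vec_def)
      show "(\<lambda>\<tau>. alg_integrand r s t p1 p2 F \<gamma> a \<tau> \<bullet> b) integrable_on {0..a}"
        by (rule integrable_eq[OF line[of k]]) (simp add: b inner_axis on_path(2))
    qed
    show "integral {0..a} (alg_integrand r s t p1 p2 F \<gamma> a) =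
          (\<chi> i. integral {0..a} (line_integrand (G i) \<gamma> a))"
    proof (rule vec_eq_iff[THEN iffD2], intro allI)
      fix i
      have "integral {0..a} (line_integrand (G i) \<gamma> a) =
          integral {0..a} (\<lambda>\<tau>. alg_integrand r s t p1 p2 F \<gamma> a \<tau> $ i)"
        by (rule integral_cong) (rule on_path(2))
      then show "integral {0..a} (alg_integrand r s t p1 p2 F \<gamma> a) $ i =
          (\<chi> i. integral {0..a} (line_integrand (G i) \<gamma> a)) $ i"
        using int by simp
    qed
  qed
  have pot: "\<exists>h. potential_on U (G i) h"
    if "open U" "simply_connected U" "U \<subseteq> regular_part" for U i
    using dual_field_potential[OF that, of i] G that(3) unfolding potential_on_def by (metis subsetD)
  have EG: "E i w \<bullet> G j w = (if i = j then 1 else 0)" if "w \<in> regular_part" for w i j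
  proof -
    have "w \<in> \<Omega>" using that by (simp add: regular_domain_def)
    then show ?thesis
      using dual_field_basis[OF that] by (simp add: E G[OF that] inner_commute)
  qed
  have antideriv1: "\<exists>A D. first_antiderivative_on U (G i) A D"
    if U: "open U" "simply_connected U" "U \<subseteq> regular_part" for U i
  proof -
    obtain h where "potential_on U (G i) h" using pot[OF U] by blast
    then have "first_antiderivative_on U (G i) h (\<lambda>w. G i w $ 2)"
      unfolding first_antiderivative_on_def partial_deriv_on_def potential_on_def
      by (blast intro: partial_derivs_of_gradient)
    then show ?thesis by blast
  qed
  have antideriv2: "\<exists>B. second_antiderivative_on U (G i) D B \<and> potential_on U (G i) (\<lambda>w. A w + B w)"
    if U: "open U" "simply_connected U" "U \<subseteq> regular_part" and AD: "first_antiderivative_on U (G i) A D" for U i A D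
  proof -
    obtain h where h: "potential_on U (G i) h" using pot[OF U] by blast
    have "second_antiderivative_on U (G i) D (\<lambda>w. h w - A w)"
      unfolding second_antiderivative_on_def partial_deriv_on_def
    proof
      fix w assume "w \<in> U"
      then show "((\<lambda>\<tau>. h (w + \<tau> *\<^sub>R axis 2 1) - A (w + \<tau> *\<^sub>R axis 2 1))
          has_real_derivative G i w $ 2 - D w) (at 0)"
        using h AD unfolding potential_on_def first_antiderivative_on_def partial_deriv_on_def
        by (intro DERIV_diff partial_derivs_of_gradient) auto
    qed
    \<comment> \<open>With this \<open>B\<close>, the sum \<open>A + B\<close> is the potential \<open>h\<close> itself.\<close>
    with h show ?thesis by (intro exI[of _ "\<lambda>w. h w - A w"]) simp
  qed
  have first_int: "first_integral_on U (E j) h"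
    if "U \<subseteq> regular_part" "i \<noteq> j" "potential_on U (G i) h" for U i j h
    unfolding first_integral_on_def
  proof
    fix w assume "w \<in> U"
    then show "\<exists>g. (GDERIV h w :> g) \<and> g \<bullet> E j w = 0"
      using that EG[of w j i] unfolding potential_on_def
      by (intro exI[of _ "G i w"]) (auto simp: inner_commute)
  qed
  show ?thesis
    unfolding conservative_on_def
    by (intro conjI allI ballI impI; (elim conjE)?;
        (rule E_forms integrals pot EG antideriv1 antideriv2 first_int; assumption))
qed

end
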